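(* Let $G$ be a finite group, $N\trianglelefteq G$ a normal subgroup, $(\theta,V)$ an irreducible $N$-representation, $I_G(\theta)$ its inertia group, and let $\Theta:I_G(\theta)\to\mathrm{End}(V)$ and the associated unitary cocycle $\eta$ on $I_G(\theta)/N$ be as in the context, with $\eta$ equalized. For each $F\in\widetilde{\mathcal H}(G,N,\theta)$ there exists $f\in L(I_G(\theta)/N)$ such that $$F(h)=\frac1{|N|}\Theta(h)^*f(hN)\quad\text{for all }h\in I_G(\theta),\qquad F(g)=0\quad\text{for }g\notin I_G(\theta).$$ Moreover, the map $$\Phi:L(I_G(\theta)/N)_\eta\to\widetilde{\mathcal H}(G,N,\theta),\qquad f\mapsto F,$$ where $F$ is given by $F(h)=\frac1{|N|}\Theta(h)^*f(hN)$ for $h\in I_G(\theta)$ and $F(g)=0$ for $g\in G\setminus I_G(\theta)$, is a $*$-isomorphism of algebras such that $\sqrt{|N|}\,\Phi$ is isometric.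
   Context: Representations are unitary on finite-dimensional complex inner product spaces. $I_G(\theta)=\{h\in G: {}^h\theta\sim\theta\}$, where ${}^h\theta(n)=\theta(h^{-1}nh)$ for $n\in N$. Let $Q\subseteq I_G(\theta)$ be a complete set of representatives of the cosets of $N$ in $I_G(\theta)$ with $1_G\in Q$. For $q\in Q$ choose a unitary operator $\Theta(q)\in\mathrm{End}(V)$ with $\theta(q^{-1}nq)=\Theta(q)^{-1}\theta(n)\Theta(q)$ for all $n\in N$, with $\Theta(1_G)=I_V$, and extend by $\Theta(nq)=\theta(n)\Theta(q)$ ($n\in N$, $q\in Q$). Then for $k,h\in I_G(\theta)$ there is $\tau(k,h)\in\mathbb T=\{z\in\mathbb C:|z|=1\}$ with $\Theta(kh)=\tau(k,h)\Theta(k)\Theta(h)$; $\tau$ depends only on the $N$-cosets of $k,h$, and $\eta(kN,hN)=\tau(k,h)$ defines a unitary cocycle on $H=I_G(\theta)/N$. A unitary cocycle $\eta:H\times H\to\mathbb T$ satisfies $\eta(1,h)=\eta(h,1)=1$ and $\eta(h_1h_2,h_3)\eta(h_1,h_2)=\eta(h_1,h_2h_3)\eta(h_2,h_3)$; it is equalized if $\eta(h,h^{-1})=1$ for all $h$. The choice of the operators $\Theta(q)$ is assumed to be such that $\eta$ is equalized. $L(H)_\eta$ is the space of functions $H\to\mathbb C$ with product $[f_1*_\eta f_2](k)=\sum_{h\in H}f_1(h^{-1}k)f_2(h)\eta(k^{-1},h)$, involution $f^*(h)=\overline{f(h^{-1})}$ and scalar product $\sum_hf_1(h)\overline{f_2(h)}$;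 it is an involutive unital associative algebra. $\widetilde{\mathcal H}(G,N,\theta)$ is the $*$-algebra of all $F:G\to\mathrm{End}(V)$ with $F(ngm)=\theta(m^{-1})F(g)\theta(n^{-1})$ for $g\in G$, $n,m\in N$, with product $[F_1*F_2](g)=\sum_{h\in G}F_1(h^{-1}g)F_2(h)$, involution $F^*(g)=[F(g^{-1})]^*$ and scalar product $\langle F_1,F_2\rangle=\sum_{g\in G}\frac{1}{\dim V}\mathrm{tr}(F_2(g)^*F_1(g))$. *)

theory Defs
  imports "HOL-Algebra.Algebra" "HOL-Algebra.Algebraic_Closure_Type"
begin

section \<open>Unitary representations\<close>

text \<open>A finite-dimensional complex inner product space is a type \<open>'v\<close> with scalar multiplication
  \<open>scale\<close>, some finite basis \<open>Basis\<close> (not required to be orthonormal; it only serves to express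
  finite-dimensionality and to compute traces), and an inner product \<open>ip\<close> that is linear in the first
  argument. Linear maps are represented by functions \<open>'v \<Rightarrow> 'v\<close>.\<close>

locale complex_inner_space = finite_dimensional_vector_space scale Basis
  for scale :: "complex \<Rightarrow> 'v::ab_group_add \<Rightarrow> 'v" and Basis :: "'v set" +
  fixes ip :: "'v \<Rightarrow> 'v \<Rightarrow> complex"
  assumes ip_add_left: "ip (u + v) w = ip u w + ip v w"
    and ip_scale_left: "ip (scale c v) w = c * ip v w"
    and ip_commute: "ip w v = cnj (ip v w)"
    and ip_pos: "v \<noteq> 0 \<Longrightarrow> 0 < Re (ip v v)"

definition End_space :: "(complex \<Rightarrow> 'v::ab_group_add \<Rightarrow> 'v) \<Rightarrow> ('v \<Rightarrow> 'v) set" where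
  "End_space scale = {A. Vector_Spaces.linear scale scale A}"

definition adjoint_op ::
  "(complex \<Rightarrow> 'v::ab_group_add \<Rightarrow> 'v) \<Rightarrow> ('v \<Rightarrow> 'v \<Rightarrow> complex) \<Rightarrow> ('v \<Rightarrow> 'v) \<Rightarrow> ('v \<Rightarrow> 'v)" where
  "adjoint_op scale ip A = (THE B. B \<in> End_space scale \<and> (\<forall>v w. ip (A v) w = ip v (B w)))"

definition unitary_op ::
  "(complex \<Rightarrow> 'v::ab_group_add \<Rightarrow> 'v) \<Rightarrow> ('v \<Rightarrow> 'v \<Rightarrow> complex) \<Rightarrow> ('v \<Rightarrow> 'v) \<Rightarrow> bool" where
  "unitary_op scale ip A \<longleftrightarrow> A \<in> End_space scale \<and> bij A \<and> (\<forall>v w. ip (A v) (A w) = ip v w)"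

definition trace_op ::
  "(complex \<Rightarrow> 'v::ab_group_add \<Rightarrow> 'v) \<Rightarrow> 'v set \<Rightarrow> ('v \<Rightarrow> 'v) \<Rightarrow> complex" where
  "trace_op scale Basis A = (\<Sum>b\<in>Basis. module.representation scale Basis (A b) b)"

definition unitary_rep ::
  "('g, 'm) monoid_scheme \<Rightarrow> (complex \<Rightarrow> 'v::ab_group_add \<Rightarrow> 'v) \<Rightarrow> ('v \<Rightarrow> 'v \<Rightarrow> complex)
    \<Rightarrow> ('g \<Rightarrow> 'v \<Rightarrow> 'v) \<Rightarrow> bool" where
  "unitary_rep K scale ip \<theta> \<longleftrightarrow>
     (\<forall>x\<in>carrier K. unitary_op scale ip (\<theta> x)) \<and>
     (\<forall>x\<in>carrier K. \<forall>y\<in>carrier K. \<theta> (x \<otimes>\<^bsub>K\<^esub> y) = \<theta> x \<circ> \<theta> y)"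

definition irreducible_rep ::
  "('g, 'm) monoid_scheme \<Rightarrow> (complex \<Rightarrow> 'v::ab_group_add \<Rightarrow> 'v) \<Rightarrow> ('g \<Rightarrow> 'v \<Rightarrow> 'v) \<Rightarrow> bool" where
  "irreducible_rep K scale \<theta> \<longleftrightarrow>
     (UNIV :: 'v set) \<noteq> {0} \<and>
     (\<forall>W. module.subspace scale W \<and> (\<forall>x\<in>carrier K. \<theta> x ` W \<subseteq> W) \<longrightarrow> W = {0} \<or> W = UNIV)"

definition equivalent_reps ::
  "('g, 'm) monoid_scheme \<Rightarrow> (complex \<Rightarrow> 'v::ab_group_add \<Rightarrow> 'v) \<Rightarrow> ('g \<Rightarrow> 'v \<Rightarrow> 'v)
    \<Rightarrow> ('g \<Rightarrow> 'v \<Rightarrow> 'v) \<Rightarrow> bool" where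
  "equivalent_reps K scale \<sigma> \<rho> \<longleftrightarrow>
     (\<exists>T\<in>End_space scale. bij T \<and> (\<forall>x\<in>carrier K. T \<circ> \<sigma> x = \<rho> x \<circ> T))"

definition conjugate_rep ::
  "('g, 'm) monoid_scheme \<Rightarrow> 'g \<Rightarrow> ('g \<Rightarrow> 'v \<Rightarrow> 'v) \<Rightarrow> ('g \<Rightarrow> 'v \<Rightarrow> 'v)" where
  "conjugate_rep G h \<theta> = (\<lambda>n. \<theta> (inv\<^bsub>G\<^esub> h \<otimes>\<^bsub>G\<^esub> n \<otimes>\<^bsub>G\<^esub> h))"

definition inertia_group ::
  "('g, 'm) monoid_scheme \<Rightarrow> 'g set \<Rightarrow> (complex \<Rightarrow> 'v::ab_group_add \<Rightarrow> 'v)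
    \<Rightarrow> ('g \<Rightarrow> 'v \<Rightarrow> 'v) \<Rightarrow> 'g set" where
  "inertia_group G N scale \<theta> =
     {h \<in> carrier G. equivalent_reps (G\<lparr>carrier := N\<rparr>) scale (conjugate_rep G h \<theta>) \<theta>}"

abbreviation inertia_quotient ::
  "('g, 'm) monoid_scheme \<Rightarrow> 'g set \<Rightarrow> (complex \<Rightarrow> 'v::ab_group_add \<Rightarrow> 'v)
    \<Rightarrow> ('g \<Rightarrow> 'v \<Rightarrow> 'v) \<Rightarrow> 'g set monoid" where
  "inertia_quotient G N scale \<theta> \<equiv> (G\<lparr>carrier := inertia_group G N scale \<theta>\<rparr>) Mod N"

section \<open>The cocycle of a family of intertwining operators\<close>

text \<open>The scalar \<open>\<tau>(k,h)\<close> of modulus one with \<open>\<Theta>(kh) = \<tau>(k,h) \<Theta>(k) \<Theta>(h)\<close>, and the function \<open>\<eta>\<close> it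
  induces on pairs of cosets. For \<open>\<theta>\<close> irreducible and \<open>\<Theta>\<close> built from a transversal of unitary
  intertwiners, each description is satisfied by exactly one complex number.\<close>

definition tau_of ::
  "('g, 'm) monoid_scheme \<Rightarrow> (complex \<Rightarrow> 'v \<Rightarrow> 'v) \<Rightarrow> ('g \<Rightarrow> 'v \<Rightarrow> 'v) \<Rightarrow> 'g \<Rightarrow> 'g \<Rightarrow> complex" where
  "tau_of G scale \<Theta> k h =
     (THE c. cmod c = 1 \<and> \<Theta> (k \<otimes>\<^bsub>G\<^esub> h) = (\<lambda>v. scale c (\<Theta> k (\<Theta> h v))))"

definition eta_of ::
  "('g, 'm) monoid_scheme \<Rightarrow> (complex \<Rightarrow> 'v \<Rightarrow> 'v) \<Rightarrow> ('g \<Rightarrow> 'v \<Rightarrow> 'v)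
    \<Rightarrow> 'g set \<Rightarrow> 'g set \<Rightarrow> complex" where
  "eta_of G scale \<Theta> A B = (THE c. \<forall>k\<in>A. \<forall>h\<in>B. tau_of G scale \<Theta> k h = c)"

definition equalized :: "('h, 'm) monoid_scheme \<Rightarrow> ('h \<Rightarrow> 'h \<Rightarrow> complex) \<Rightarrow> bool" where
  "equalized H \<eta> \<longleftrightarrow> (\<forall>h\<in>carrier H. \<eta> h (inv\<^bsub>H\<^esub> h) = 1)"

section \<open>Involutive algebras\<close>

record 'a star_alg = "(complex, 'a) module" +
  star :: "'a \<Rightarrow> 'a"
  sprod :: "'a \<Rightarrow> 'a \<Rightarrow> complex"

text \<open>The library's locale \<open>algebra\<close> is restricted to commutative algebras.\<close>

locale involutive_algebra =
  ring A + Module.module "ring_of_type_algebra :: complex ring" A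
  for A :: "('a, 'm) star_alg_scheme" (structure) +
  assumes smult_mult_left:
      "\<lbrakk>x \<in> carrier A; y \<in> carrier A\<rbrakk> \<Longrightarrow> (c \<odot>\<^bsub>A\<^esub> x) \<otimes>\<^bsub>A\<^esub> y = c \<odot>\<^bsub>A\<^esub> (x \<otimes>\<^bsub>A\<^esub> y)"
    and smult_mult_right:
      "\<lbrakk>x \<in> carrier A; y \<in> carrier A\<rbrakk> \<Longrightarrow> x \<otimes>\<^bsub>A\<^esub> (c \<odot>\<^bsub>A\<^esub> y) = c \<odot>\<^bsub>A\<^esub> (x \<otimes>\<^bsub>A\<^esub> y)"
    and star_closed: "x \<in> carrier A \<Longrightarrow> star A x \<in> carrier A"
    and star_star: "x \<in> carrier A \<Longrightarrow> star A (star A x) = x"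
    and star_add:
      "\<lbrakk>x \<in> carrier A; y \<in> carrier A\<rbrakk> \<Longrightarrow> star A (x \<oplus>\<^bsub>A\<^esub> y) = star A x \<oplus>\<^bsub>A\<^esub> star A y"
    and star_smult: "x \<in> carrier A \<Longrightarrow> star A (c \<odot>\<^bsub>A\<^esub> x) = cnj c \<odot>\<^bsub>A\<^esub> star A x"
    and star_mult:
      "\<lbrakk>x \<in> carrier A; y \<in> carrier A\<rbrakk> \<Longrightarrow> star A (x \<otimes>\<^bsub>A\<^esub> y) = star A y \<otimes>\<^bsub>A\<^esub> star A x"

definition star_iso ::
  "('a, 'm) star_alg_scheme \<Rightarrow> ('b, 'n) star_alg_scheme \<Rightarrow> ('a \<Rightarrow> 'b) \<Rightarrow> bool" where
  "star_iso A B \<Phi> \<longleftrightarrow>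
     involutive_algebra A \<and> involutive_algebra B \<and>
     \<Phi> \<in> ring_iso A B \<and>
     (\<forall>c. \<forall>x\<in>carrier A. \<Phi> (c \<odot>\<^bsub>A\<^esub> x) = c \<odot>\<^bsub>B\<^esub> \<Phi> x) \<and>
     (\<forall>x\<in>carrier A. \<Phi> (star A x) = star B (\<Phi> x))"

text \<open>The twisted group algebra \<open>L(H)\<^sub>\<eta>\<close>. Functions on a group are taken to be \<open>undefined\<close> outside
  its carrier, here and for the Hecke algebra below.\<close>

definition twisted_group_algebra ::
  "('h, 'm) monoid_scheme \<Rightarrow> ('h \<Rightarrow> 'h \<Rightarrow> complex) \<Rightarrow> ('h \<Rightarrow> complex) star_alg" where
  "twisted_group_algebra H \<eta> =
     \<lparr> carrier = carrier H \<rightarrow>\<^sub>E UNIV,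
       monoid.mult = (\<lambda>f\<^sub>1 f\<^sub>2. \<lambda>k\<in>carrier H.
                 \<Sum>h\<in>carrier H. f\<^sub>1 (inv\<^bsub>H\<^esub> h \<otimes>\<^bsub>H\<^esub> k) * f\<^sub>2 h * \<eta> (inv\<^bsub>H\<^esub> k) h),
       one = (\<lambda>k\<in>carrier H. if k = \<one>\<^bsub>H\<^esub> then 1 else 0),
       ring.zero = (\<lambda>k\<in>carrier H. 0),
       add = (\<lambda>f\<^sub>1 f\<^sub>2. \<lambda>k\<in>carrier H. f\<^sub>1 k + f\<^sub>2 k),
       Module.module.smult = (\<lambda>c f. \<lambda>k\<in>carrier H. c * f k),
       star = (\<lambda>f. \<lambda>h\<in>carrier H. cnj (f (inv\<^bsub>H\<^esub> h))),
       sprod = (\<lambda>f\<^sub>1 f\<^sub>2. \<Sum>h\<in>carrier H. f\<^sub>1 h * cnj (f\<^sub>2 h)) \<rparr>"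

text \<open>The unit of the Hecke algebra is \<open>n \<mapsto> |N|\<^sup>-\<^sup>1 \<theta>(n\<^sup>-\<^sup>1)\<close> on \<open>N\<close>, extended by zero.\<close>

definition hecke_algebra ::
  "('g, 'm) monoid_scheme \<Rightarrow> 'g set \<Rightarrow> (complex \<Rightarrow> 'v::ab_group_add \<Rightarrow> 'v) \<Rightarrow> 'v set
    \<Rightarrow> ('v \<Rightarrow> 'v \<Rightarrow> complex) \<Rightarrow> ('g \<Rightarrow> 'v \<Rightarrow> 'v) \<Rightarrow> ('g \<Rightarrow> 'v \<Rightarrow> 'v) star_alg" where
  "hecke_algebra G N scale Basis ip \<theta> =
     \<lparr> carrier = {F \<in> carrier G \<rightarrow>\<^sub>E End_space scale.
                    \<forall>g\<in>carrier G. \<forall>n\<in>N. \<forall>m\<in>N.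
                      F (n \<otimes>\<^bsub>G\<^esub> g \<otimes>\<^bsub>G\<^esub> m) = \<theta> (inv\<^bsub>G\<^esub> m) \<circ> F g \<circ> \<theta> (inv\<^bsub>G\<^esub> n)},
       monoid.mult = (\<lambda>F\<^sub>1 F\<^sub>2. \<lambda>g\<in>carrier G. \<lambda>v.
                 \<Sum>h\<in>carrier G. F\<^sub>1 (inv\<^bsub>G\<^esub> h \<otimes>\<^bsub>G\<^esub> g) (F\<^sub>2 h v)),
       one = (\<lambda>g\<in>carrier G. \<lambda>v.
                 if g \<in> N then scale (1 / of_nat (card N)) (\<theta> (inv\<^bsub>G\<^esub> g) v) else 0),
       ring.zero = (\<lambda>g\<in>carrier G. \<lambda>v. 0),
       add = (\<lambda>F\<^sub>1 F\<^sub>2. \<lambda>g\<in>carrier G. \<lambda>v. F\<^sub>1 g v + F\<^sub>2 g v),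
       Module.module.smult = (\<lambda>c F. \<lambda>g\<in>carrier G. \<lambda>v. scale c (F g v)),
       star = (\<lambda>F. \<lambda>g\<in>carrier G. adjoint_op scale ip (F (inv\<^bsub>G\<^esub> g))),
       sprod = (\<lambda>F\<^sub>1 F\<^sub>2. \<Sum>g\<in>carrier G.
                 1 / of_nat (vector_space.dim scale (UNIV :: 'v set)) *
                 trace_op scale Basis (adjoint_op scale ip (F\<^sub>2 g) \<circ> F\<^sub>1 g)) \<rparr>"

definition Phi_map ::
  "('g, 'm) monoid_scheme \<Rightarrow> 'g set \<Rightarrow> (complex \<Rightarrow> 'v::ab_group_add \<Rightarrow> 'v)
    \<Rightarrow> ('v \<Rightarrow> 'v \<Rightarrow> complex) \<Rightarrow> ('g \<Rightarrow> 'v \<Rightarrow> 'v) \<Rightarrow> ('g \<Rightarrow> 'v \<Rightarrow> 'v)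
    \<Rightarrow> ('g set \<Rightarrow> complex) \<Rightarrow> ('g \<Rightarrow> 'v \<Rightarrow> 'v)" where
  "Phi_map G N scale ip \<theta> \<Theta> f = (\<lambda>g\<in>carrier G. \<lambda>v.
     if g \<in> inertia_group G N scale \<theta>
     then scale (1 / of_nat (card N) * f (g <#\<^bsub>G\<^esub> N)) (adjoint_op scale ip (\<Theta> g) v)
     else 0)"

end

theory Submission
  imports Defs "HOL-Computational_Algebra.Fundamental_Theorem_Algebra"
begin

text \<open>The covariance of \<open>F\<close> says that \<open>F g\<close> intertwines \<open>\<theta>\<close> with its conjugate by \<open>g\<close>. By Schur's lemma
  \<open>F g\<close> vanishes for \<open>g \<notin> I\<close>, and for \<open>g \<in> I\<close> the operator \<open>\<Theta> g \<circ> F g\<close> is a scalar, which depends only on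
  the coset of \<open>g\<close> because \<open>\<Theta> (g n) = \<Theta> g \<circ> \<theta> n\<close>; hence \<open>\<Phi>\<close> is a bijection. It is multiplicative because an
  equalized cocycle satisfies \<open>\<eta> (g\<inverse>, h) = \<eta> (h, h\<inverse> g)\<close>, and it respects the involution because
  \<open>\<Theta> (g\<inverse>) = \<Theta> g\<^sup>*\<close>. That the Hecke algebra is an involutive algebra is transported from the twisted
  group algebra along \<open>\<Phi>\<close>, so that adjoints are only ever needed for multiples of unitary operators.\<close>

section \<open>Schur's lemma and unitary operators\<close>

text \<open>The iterates up to index \<open>card Basis\<close> are one more than the dimension.
  Dependence is a property of sets, so coinciding iterates form a separate case, in which the
  difference of the two is the relation.\<close>

lemma (in finite_dimensional_vector_space) linear_relation_of_iterates:
  obtains a n where "(\<Sum>i\<le>n. scale (a i) ((T ^^ i) v)) = 0" and "\<exists>i\<le>n. a i \<noteq> 0"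
proof (cases "inj_on (\<lambda>i. (T ^^ i) v) {..card Basis}")
  case True
  let ?n = "card Basis"
  let ?S = "(\<lambda>i. (T ^^ i) v) ` {..?n}"
  have "card ?S = Suc ?n" using True by (simp add: card_image)
  then have "dependent ?S"
    using independent_card_le_dim[of ?S UNIV] by auto
  then obtain u where u: "(\<Sum>w\<in>?S. scale (u w) w) = 0" "\<exists>w\<in>?S. u w \<noteq> 0"
    by (auto simp: dependent_finite)
  show ?thesis
  proof (rule that)
    show "(\<Sum>i\<le>?n. scale (u ((T ^^ i) v)) ((T ^^ i) v)) = 0"
      using u(1) True by (simp add: sum.reindex)
    show "\<exists>i\<le>?n. u ((T ^^ i) v) \<noteq> 0" using u(2) by auto
  qed
next
  case False
  let ?n = "card Basis"
  obtain i j where ij: "i \<le> ?n" "j \<le> ?n" "i \<noteq> j" "(T ^^ i) v = (T ^^ j) v"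
    using False by (auto simp: inj_on_def)
  define a :: "nat \<Rightarrow> 'a" where "a k = (if k = i then 1 else if k = j then -1 else 0)" for k
  have "(\<Sum>k\<le>?n. scale (a k) ((T ^^ k) v)) = (\<Sum>k\<in>{i, j}. scale (a k) ((T ^^ k) v))"
    using ij by (intro sum.mono_neutral_right) (auto simp: a_def)
  also have "\<dots> = 0" using ij by (simp add: a_def)
  finally show ?thesis
    using ij(1) by (intro that[of a ?n] exI[of _ i]) (simp_all add: a_def)
qed

text \<open>The iterates of \<open>v\<close> give a nonzero polynomial p with p(T) v = 0. Splitting
  off a root c, p = (X - c) q, either q(T) v is an eigenvector for c, or q also annihilates
  \<open>v\<close> and has smaller degree.\<close>

lemma linear_eigenvector_exists:
  fixes scale :: "'a::alg_closed_field \<Rightarrow> 'v::ab_group_add \<Rightarrow> 'v" and v :: 'v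
  assumes fd: "finite_dimensional_vector_space scale Basis"
    and lin: "Vector_Spaces.linear scale scale T"
    and v: "v \<noteq> 0"
  obtains c w where "w \<noteq> 0" "T w = scale c w"
proof -
  interpret finite_dimensional_vector_space scale Basis by (rule fd)
  interpret T: Vector_Spaces.linear scale scale T by (rule lin)
  \<comment> \<open>The sum stops exactly at the degree, so that \<open>n = 0\<close> means a
    nonzero constant, which cannot kill \<open>v\<close>.\<close>
  have ex: "\<exists>c w. w \<noteq> 0 \<and> T w = scale c w"
    if "degree p = n" "p \<noteq> 0" "(\<Sum>i\<le>n. scale (coeff p i) ((T ^^ i) v)) = 0" for p :: "'a poly" and n
    using that
  proof (induction n arbitrary: p)
    case 0
    then have "coeff p 0 \<noteq> 0" using leading_coeff_0_iff by metis
    with 0 v show ?case by simp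
  next
    case (Suc m)
    obtain c where "poly p c = 0"
      using alg_closed_imp_poly_has_root[of p] Suc.prems by auto
    then obtain q where p: "p = [:-c, 1:] * q" by (auto simp: poly_eq_0_iff_dvd)
    have q0: "q \<noteq> 0" using Suc.prems p by auto
    then have dq: "degree q = m" using Suc.prems(1) unfolding p
      by (subst (asm) degree_mult_eq) auto
    define w where "w = (\<Sum>i\<le>m. scale (coeff q i) ((T ^^ i) v))"
    have cq: "coeff q (Suc m) = 0" using dq by (simp add: coeff_eq_0)
    \<comment> \<open>Written as X q - c q, the relation becomes \<open>T w - scale c w = 0\<close>;
      the last term of the second sum vanishes by \<open>cq\<close>.\<close>
    have p': "p = pCons 0 q - smult c q" by (simp add: p)
    have "0 = (\<Sum>i\<le>Suc m. scale (coeff (pCons 0 q) i) ((T ^^ i) v))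
        - (\<Sum>i\<le>Suc m. scale (c * coeff q i) ((T ^^ i) v))"
      using Suc.prems(3) unfolding p' by (simp add: scale_left_diff_distrib sum_subtractf)
    also have "(\<Sum>i\<le>Suc m. scale (coeff (pCons 0 q) i) ((T ^^ i) v)) = T w"
      by (subst sum.atMost_Suc_shift) (simp add: w_def T.sum T.scale)
    also have "(\<Sum>i\<le>Suc m. scale (c * coeff q i) ((T ^^ i) v)) = scale c w"
      by (simp add: cq w_def scale_sum_right)
    finally have "T w = scale c w" by simp
    then show ?case
      using Suc.IH[OF dq q0] w_def by blast
  qed
  obtain a n where a: "(\<Sum>i\<le>n. scale (a i) ((T ^^ i) v)) = 0" "\<exists>i\<le>n. a i \<noteq> 0"
    by (rule linear_relation_of_iterates)
  define p where "p = (\<Sum>i\<le>n. monom (a i) i)"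
  have cp: "coeff p i = (if i \<le> n then a i else 0)" for i
    by (simp add: p_def coeff_sum)
  have p0: "p \<noteq> 0" using a(2) cp by (metis coeff_0)
  have dp: "degree p \<le> n" by (rule degree_le) (simp add: cp)
  \<comment> \<open>The top coefficients of the relation may vanish, so the sum is cut back to the
    true degree of \<open>p\<close>.\<close>
  have "(\<Sum>i\<le>degree p. scale (coeff p i) ((T ^^ i) v)) = (\<Sum>i\<le>n. scale (coeff p i) ((T ^^ i) v))"
    using dp by (intro sum.mono_neutral_left) (auto simp: coeff_eq_0)
  also have "\<dots> = 0" using a(1) by (simp add: cp)
  finally show ?thesis using ex[OF refl p0] that by blast
qed

context complex_inner_space
begin

text \<open>The kernel of \<open>T\<close> is stable under \<open>\<sigma>\<close>, hence zero, and
  an injective endomorphism in finite dimension is onto. The target \<open>\<rho>\<close> is left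
  general because it will be \<open>\<theta>\<close> at the conjugated elements
  \<open>inv g \<otimes> n \<otimes> g\<close>.\<close>

lemma schur_bij:
  assumes irr: "irreducible_rep K scale \<sigma>"
    and T: "T \<in> End_space scale" "T \<noteq> (\<lambda>v. 0)"
    and comm: "\<And>x v. x \<in> carrier K \<Longrightarrow> T (\<sigma> x v) = \<rho> x (T v)"
    and zero: "\<And>x. x \<in> carrier K \<Longrightarrow> \<rho> x 0 = 0"
  shows "bij T"
proof -
  interpret T: Vector_Spaces.linear scale scale T using T by (simp add: End_space_def)
  let ?W = "{v. T v = 0}"
  have "\<sigma> x ` ?W \<subseteq> ?W" if "x \<in> carrier K" for x
    using comm[OF that] zero[OF that] by auto
  then have "?W = {0} \<or> ?W = UNIV"
    using irr T.subspace_kernel unfolding irreducible_rep_def by blast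
  then have "?W = {0}" using T(2) by auto
  then have "inj T" by (auto simp: T.inj_iff_eq_0)
  then show ?thesis
    using linear_inj_imp_surj[OF T.linear_axioms] by (simp add: bij_def)
qed

text \<open>An eigenspace of \<open>T\<close> is nonzero and stable under \<open>\<sigma>\<close>,
  hence the whole space.\<close>

lemma schur_scalar:
  assumes irr: "irreducible_rep K scale \<sigma>"
    and \<sigma>: "\<And>x. x \<in> carrier K \<Longrightarrow> \<sigma> x \<in> End_space scale"
    and T: "T \<in> End_space scale"
    and comm: "\<And>x v. x \<in> carrier K \<Longrightarrow> T (\<sigma> x v) = \<sigma> x (T v)"
  obtains c where "T = scale c"
proof -
  interpret T: Vector_Spaces.linear scale scale T using T by (simp add: End_space_def)
  obtain v :: 'v where v: "v \<noteq> 0"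
    using irr unfolding irreducible_rep_def by auto
  obtain c w where w: "w \<noteq> 0" "T w = scale c w"
    using linear_eigenvector_exists[OF finite_dimensional_vector_space_axioms T.linear_axioms v] .
  let ?W = "{v. T v = scale c v}"
  have "subspace ?W"
    by (auto simp: subspace_def T.add T.scale T.zero scale_right_distrib mult.commute)
  moreover have "\<sigma> x ` ?W \<subseteq> ?W" if "x \<in> carrier K" for x
  proof -
    interpret S: Vector_Spaces.linear scale scale "\<sigma> x" using \<sigma>[OF that] by (simp add: End_space_def)
    show ?thesis using comm[OF that] by (auto simp: S.scale)
  qed
  ultimately have "?W = {0} \<or> ?W = UNIV"
    using irr unfolding irreducible_rep_def by blast
  then have "T = scale c" using w by auto
  then show ?thesis by (rule that)
qed

section \<open>Unitary operators, their adjoints and traces\<close>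

lemma ip_scale_right: "ip v (scale c w) = cnj c * ip v w"
  by (metis complex_cnj_mult ip_commute ip_scale_left)

lemma ip_diff_left: "ip (u - v) w = ip u w - ip v w"
  by (metis add_diff_cancel_right' diff_add_cancel ip_add_left)

lemma ip_right_ext:
  assumes "\<And>v. ip v x = ip v y"
  shows "x = y"
proof (rule ccontr)
  assume "x \<noteq> y"
  then have "0 < Re (ip (x - y) (x - y))" by (intro ip_pos) simp
  moreover have "ip (x - y) (x - y) = 0"
    using assms by (metis cancel_comm_monoid_add_class.diff_cancel complex_cnj_zero ip_commute ip_diff_left)
  ultimately show False by simp
qed

lemma unitary_op_linear: "unitary_op scale ip U \<Longrightarrow> Vector_Spaces.linear scale scale U"
  by (simp add: unitary_op_def End_space_def)

lemma unitary_op_scale: "unitary_op scale ip U \<Longrightarrow> U (scale c v) = scale c (U v)"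
  using Vector_Spaces.linear.axioms(3)[OF unitary_op_linear] module_hom.scale by blast

lemma unitary_op_zero: "unitary_op scale ip U \<Longrightarrow> U 0 = 0"
  using unitary_op_scale[of U 0 0] by simp

lemma unitary_op_id: "unitary_op scale ip id"
  by (simp add: unitary_op_def End_space_def linear_id)

lemma unitary_op_inv:
  assumes "unitary_op scale ip U"
  shows "unitary_op scale ip (inv_into UNIV U)"
proof -
  interpret U: Vector_Spaces.linear scale scale U using assms by (rule unitary_op_linear)
  have b: "bij U" using assms by (simp add: unitary_op_def)
  have [simp]: "U (inv_into UNIV U v) = v" for v using b by (simp add: bij_is_surj surj_f_inv_f)
  have eq: "inv_into UNIV U v = w" if "v = U w" for v w using b that by (simp add: bij_is_inj inv_f_f)
  have "Vector_Spaces.linear scale scale (inv_into UNIV U)"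
    by unfold_locales (auto intro!: eq simp: U.add U.scale)
  moreover have "ip (inv_into UNIV U v) (inv_into UNIV U w) = ip v w" for v w
    using assms unfolding unitary_op_def
    by (metis \<open>\<And>v. U (inv_into UNIV U v) = v\<close>)
  ultimately show ?thesis using b by (simp add: unitary_op_def End_space_def bij_imp_bij_inv)
qed

lemma unitary_op_comp:
  assumes "unitary_op scale ip U" "unitary_op scale ip V"
  shows "unitary_op scale ip (U \<circ> V)"
  using assms Vector_Spaces.linear_compose[of scale scale V scale U]
  by (auto simp: unitary_op_def End_space_def bij_comp)

lemma scale_unitary_in_End:
  assumes "unitary_op scale ip U"
  shows "(\<lambda>v. scale c (U v)) \<in> End_space scale"
proof -
  interpret U: Vector_Spaces.linear scale scale U using assms by (rule unitary_op_linear)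
  show ?thesis unfolding End_space_def mem_Collect_eq
    by unfold_locales (auto simp: U.add U.scale scale_right_distrib mult.commute)
qed

text \<open>\<open>adjoint_op\<close> is a definite description, so a witness and its uniqueness are
  owed. The inverse of \<open>U\<close> supplies the witness and nondegeneracy
  (\<open>ip_right_ext\<close>) the uniqueness; \<open>c = 0\<close> covers the zero
  operator.\<close>

lemma adjoint_op_scale_unitary:
  assumes "unitary_op scale ip U"
  shows "adjoint_op scale ip (\<lambda>v. scale c (U v)) = (\<lambda>v. scale (cnj c) (inv_into UNIV U v))"
  unfolding adjoint_op_def
proof (rule the_equality)
  have U': "unitary_op scale ip (inv_into UNIV U)" using assms by (rule unitary_op_inv)
  have *: "ip (scale c (U v)) w = ip v (scale (cnj c) (inv_into UNIV U w))" for v w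
    using assms unfolding unitary_op_def
    by (metis bij_is_surj complex_cnj_cnj ip_scale_left ip_scale_right surj_f_inv_f)
  with scale_unitary_in_End[OF U']
  show "(\<lambda>v. scale (cnj c) (inv_into UNIV U v)) \<in> End_space scale \<and>
    (\<forall>v w. ip (scale c (U v)) w = ip v (scale (cnj c) (inv_into UNIV U w)))" by blast
  fix B assume "B \<in> End_space scale \<and> (\<forall>v w. ip (scale c (U v)) w = ip v (B w))"
  then show "B = (\<lambda>v. scale (cnj c) (inv_into UNIV U v))"
    by (intro ext ip_right_ext) (simp flip: *)
qed

lemma adjoint_op_unitary:
  "unitary_op scale ip U \<Longrightarrow> adjoint_op scale ip U = inv_into UNIV U"
  using adjoint_op_scale_unitary[of U 1] by simp

lemma adjoint_op_zero: "adjoint_op scale ip (\<lambda>v. 0) = (\<lambda>v. 0)"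
  using adjoint_op_scale_unitary[OF unitary_op_id, of 0] by simp

text \<open>The only trace ever computed: the operators in the scalar product of two images under
  \<open>\<Phi>\<close> turn out to be scalars.\<close>

lemma trace_op_scale: "trace_op scale Basis (scale c) = c * of_nat (dim UNIV)"
proof -
  have "representation Basis (scale c b) b = c" if "b \<in> Basis" for b
    using that by (simp add: representation_scale[OF independent_Basis] span_Basis
        representation_basis[OF independent_Basis])
  then show ?thesis by (simp add: trace_op_def)
qed

end

section \<open>Involutive algebras\<close>

text \<open>Introduction rule with plain complex numbers as scalars; the scalar ring
  \<open>ring_of_type_algebra\<close> is unfolded once, here, and the next lemma translates
  back.\<close>

lemma involutive_algebraI:
  fixes A :: "('a, 'm) star_alg_scheme" (structure)
  assumes "ring A"
    and "\<And>c x. x \<in> carrier A \<Longrightarrow> c \<odot> x \<in> carrier A"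
    and "\<And>c d x. x \<in> carrier A \<Longrightarrow> (c + d) \<odot> x = c \<odot> x \<oplus> d \<odot> x"
    and "\<And>c x y. x \<in> carrier A \<Longrightarrow> y \<in> carrier A \<Longrightarrow> c \<odot> (x \<oplus> y) = c \<odot> x \<oplus> c \<odot> y"
    and "\<And>c d x. x \<in> carrier A \<Longrightarrow> (c * d) \<odot> x = c \<odot> (d \<odot> x)"
    and "\<And>x. x \<in> carrier A \<Longrightarrow> 1 \<odot> x = x"
    and "\<And>c x y. x \<in> carrier A \<Longrightarrow> y \<in> carrier A \<Longrightarrow> (c \<odot> x) \<otimes> y = c \<odot> (x \<otimes> y)"
    and "\<And>c x y. x \<in> carrier A \<Longrightarrow> y \<in> carrier A \<Longrightarrow> x \<otimes> (c \<odot> y) = c \<odot> (x \<otimes> y)"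
    and "\<And>x. x \<in> carrier A \<Longrightarrow> star A x \<in> carrier A"
    and "\<And>x. x \<in> carrier A \<Longrightarrow> star A (star A x) = x"
    and "\<And>x y. x \<in> carrier A \<Longrightarrow> y \<in> carrier A \<Longrightarrow> star A (x \<oplus> y) = star A x \<oplus> star A y"
    and "\<And>c x. x \<in> carrier A \<Longrightarrow> star A (c \<odot> x) = cnj c \<odot> star A x"
    and "\<And>x y. x \<in> carrier A \<Longrightarrow> y \<in> carrier A \<Longrightarrow> star A (x \<otimes> y) = star A y \<otimes> star A x"
  shows "involutive_algebra A"
proof -
  interpret ring A by fact
  have "Module.module (ring_of_type_algebra :: complex ring) A"
    by (rule moduleI) (use assms in \<open>auto simp: cring_from_type_algebra is_abelian_group,
      auto simp: ring_of_type_algebra_def\<close>)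
  then show ?thesis
    by (intro involutive_algebra.intro involutive_algebra_axioms.intro) (use assms in auto)
qed

lemma (in involutive_algebra)
  shows smult_in_carrier: "x \<in> carrier A \<Longrightarrow> c \<odot> x \<in> carrier A"
    and smult_add_left: "x \<in> carrier A \<Longrightarrow> (c + d) \<odot> x = c \<odot> x \<oplus> d \<odot> x"
    and smult_add_right:
      "x \<in> carrier A \<Longrightarrow> y \<in> carrier A \<Longrightarrow> c \<odot> (x \<oplus> y) = c \<odot> x \<oplus> c \<odot> y"
    and smult_smult: "x \<in> carrier A \<Longrightarrow> (c * d) \<odot> x = c \<odot> (d \<odot> x)"
    and smult_1: "x \<in> carrier A \<Longrightarrow> 1 \<odot> x = x"
  using smult_closed[of c x] smult_l_distr[of c d x] smult_r_distr[of c x y] smult_assoc1[of c d x]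
    smult_one[of x]
  by (simp_all add: ring_of_type_algebra_def)

text \<open>All axioms are identities, closure or existence statements, so they pass to a
  homomorphic image. For the Hecke algebra this replaces a direct verification.\<close>

lemma involutive_algebra_image:
  fixes A :: "('a, 'm) star_alg_scheme" (structure) and B :: "('b, 'n) star_alg_scheme"
  assumes "involutive_algebra A"
    and img: "carrier B = \<Phi> ` carrier A"
    and hom_mult: "\<And>x y. x \<in> carrier A \<Longrightarrow> y \<in> carrier A \<Longrightarrow> \<Phi> (x \<otimes> y) = \<Phi> x \<otimes>\<^bsub>B\<^esub> \<Phi> y"
    and hom_add: "\<And>x y. x \<in> carrier A \<Longrightarrow> y \<in> carrier A \<Longrightarrow> \<Phi> (x \<oplus> y) = \<Phi> x \<oplus>\<^bsub>B\<^esub> \<Phi> y"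
    and hom_one: "\<Phi> \<one> = \<one>\<^bsub>B\<^esub>" and hom_zero: "\<Phi> \<zero> = \<zero>\<^bsub>B\<^esub>"
    and hom_smult: "\<And>c x. x \<in> carrier A \<Longrightarrow> \<Phi> (c \<odot> x) = c \<odot>\<^bsub>B\<^esub> \<Phi> x"
    and hom_star: "\<And>x. x \<in> carrier A \<Longrightarrow> \<Phi> (star A x) = star B (\<Phi> x)"
  shows "involutive_algebra B"
proof -
  interpret ring A using \<open>involutive_algebra A\<close> by (rule involutive_algebra.axioms)
  interpret inv: involutive_algebra A by fact
  \<comment> \<open>Reversed, these equations gather an expression in images into a single image
    under \<open>\<Phi>\<close>.\<close>
  note hom = hom_mult[symmetric] hom_add[symmetric] hom_one[symmetric] hom_zero[symmetric]
    hom_smult[symmetric] hom_star[symmetric]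
  have "abelian_group B"
  proof (rule abelian_groupI)
    fix x assume "x \<in> carrier B"
    then obtain a where "a \<in> carrier A" "x = \<Phi> a" by (auto simp: img)
    then show "\<exists>y\<in>carrier B. y \<oplus>\<^bsub>B\<^esub> x = \<zero>\<^bsub>B\<^esub>"
      by (intro bexI[of _ "\<Phi> (\<ominus> a)"]) (auto simp: hom img l_neg)
  qed (auto simp: img hom a_ac)
  moreover have "monoid B"
    by (rule monoidI) (auto simp: img hom m_assoc)
  ultimately have "ring B"
    by (rule ringI) (auto simp: img hom l_distr r_distr)
  then show ?thesis
    by (rule involutive_algebraI)
      (auto simp: img hom inv.smult_in_carrier inv.smult_add_left inv.smult_add_right
        inv.smult_smult inv.smult_1 inv.smult_mult_left inv.smult_mult_right inv.star_closed
        inv.star_star inv.star_add inv.star_smult inv.star_mult)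
qed

section \<open>The twisted group algebra\<close>

locale equalized_unitary_cocycle = group G for G :: "'g monoid" (structure) +
  fixes \<eta> :: "'g \<Rightarrow> 'g \<Rightarrow> complex"
  assumes finite_carrier: "finite (carrier G)"
    and eta_unit: "\<lbrakk>x \<in> carrier G; y \<in> carrier G\<rbrakk> \<Longrightarrow> cmod (\<eta> x y) = 1"
    and eta_one_left: "x \<in> carrier G \<Longrightarrow> \<eta> \<one> x = 1"
    and eta_one_right: "x \<in> carrier G \<Longrightarrow> \<eta> x \<one> = 1"
    and eta_cocycle: "\<lbrakk>x \<in> carrier G; y \<in> carrier G; z \<in> carrier G\<rbrakk> \<Longrightarrow>
      \<eta> (x \<otimes> y) z * \<eta> x y = \<eta> x (y \<otimes> z) * \<eta> y z"
    and eta_equalized: "equalized G \<eta>"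
begin

section \<open>Consequences of equalization\<close>

lemma eta_inv_right: "x \<in> carrier G \<Longrightarrow> \<eta> x (inv x) = 1"
  using eta_equalized by (simp add: equalized_def)

lemma eta_inv_left: "x \<in> carrier G \<Longrightarrow> \<eta> (inv x) x = 1"
  using eta_inv_right[of "inv x"] by simp

text \<open>The cocycle identity for \<open>inv g\<close>, \<open>h\<close>,
  \<open>inv h \<otimes> g\<close>: equalization makes the two other factors 1, since
  \<open>inv g \<otimes> h\<close> and \<open>inv h \<otimes> g\<close> are mutually inverse. It
  links the twist of the convolution to the scalar that arises from composing intertwiners.\<close>

lemma eta_shift:
  assumes "g \<in> carrier G" "h \<in> carrier G"
  shows "\<eta> (inv g) h = \<eta> h (inv h \<otimes> g)"
proof -
  have "\<eta> (inv g \<otimes> h) (inv h \<otimes> g) = 1"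
    using eta_inv_right[of "inv g \<otimes> h"] assms by (simp add: inv_mult_group)
  moreover have "h \<otimes> (inv h \<otimes> g) = g"
    using assms by (simp flip: m_assoc)
  ultimately show ?thesis
    using eta_cocycle[of "inv g" h "inv h \<otimes> g"] assms by (simp add: eta_inv_left)
qed

text \<open>The cocycle identity for \<open>inv g\<close>, \<open>g\<close>, \<open>h\<close> makes
  the right-hand side the inverse of \<open>\<eta> g h\<close>, and the inverse of a number of
  modulus one is its conjugate.\<close>

lemma cnj_eta:
  assumes "g \<in> carrier G" "h \<in> carrier G"
  shows "cnj (\<eta> g h) = \<eta> (inv g) (g \<otimes> h)"
proof -
  have "\<eta> (inv g) (g \<otimes> h) * \<eta> g h = 1"
    using eta_cocycle[of "inv g" g h] assms by (simp add: eta_inv_left eta_one_left)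
  moreover have "\<eta> g h * cnj (\<eta> g h) = 1"
    using eta_unit[OF assms] by (simp add: complex_norm_square[symmetric])
  ultimately show ?thesis
    by (metis mult.assoc mult.commute mult.right_neutral)
qed

lemma sum_translate:
  assumes "g \<in> carrier G"
  shows "(\<Sum>h\<in>carrier G. F (g \<otimes> h)) = (\<Sum>h\<in>carrier G. F h)"
proof (rule sum.reindex_bij_betw)
  show "bij_betw ((\<otimes>) g) (carrier G) (carrier G)"
    by (rule bij_betw_byWitness[where f' = "(\<otimes>) (inv g)"])
      (use assms in \<open>auto simp flip: m_assoc\<close>)
qed

section \<open>Algebra axioms of the twisted group algebra\<close>

abbreviation A where "A \<equiv> twisted_group_algebra G \<eta>"

lemma carrier_ext:
  assumes "x \<in> carrier A" "y \<in> carrier A" "\<And>k. k \<in> carrier G \<Longrightarrow> x k = y k"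
  shows "x = y"
  using assms by (auto simp: twisted_group_algebra_def intro: PiE_ext)

lemma mult_closed: "x \<otimes>\<^bsub>A\<^esub> y \<in> carrier A"
  by (simp add: twisted_group_algebra_def)

text \<open>After the substitution of \<open>l \<otimes> h\<close> for \<open>h\<close> the two
  double sums agree term by term.\<close>

lemma mult_assoc:
  assumes "x \<in> carrier A" "y \<in> carrier A" "z \<in> carrier A"
  shows "x \<otimes>\<^bsub>A\<^esub> y \<otimes>\<^bsub>A\<^esub> z = x \<otimes>\<^bsub>A\<^esub> (y \<otimes>\<^bsub>A\<^esub> z)"
proof (rule carrier_ext[OF mult_closed mult_closed])
  fix k assume k: "k \<in> carrier G"
  have "(x \<otimes>\<^bsub>A\<^esub> (y \<otimes>\<^bsub>A\<^esub> z)) k = (\<Sum>l\<in>carrier G. \<Sum>h\<in>carrier G.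
      x (inv h \<otimes> k) * y (inv l \<otimes> h) * z l * \<eta> (inv h) l * \<eta> (inv k) h)"
    using k by (subst sum.swap) (simp add: twisted_group_algebra_def sum_distrib_left sum_distrib_right mult.assoc)
  also have "\<dots> = (\<Sum>l\<in>carrier G. \<Sum>h\<in>carrier G.
      x (inv (l \<otimes> h) \<otimes> k) * y (inv l \<otimes> (l \<otimes> h)) * z l * \<eta> (inv (l \<otimes> h)) l * \<eta> (inv k) (l \<otimes> h))"
    by (intro sum.cong refl sum_translate[symmetric])
  also have "\<dots> = (\<Sum>l\<in>carrier G. \<Sum>h\<in>carrier G.
      x (inv h \<otimes> (inv l \<otimes> k)) * y h * \<eta> (inv (inv l \<otimes> k)) h * z l * \<eta> (inv k) l)"
  proof (intro sum.cong refl)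
    fix l h assume lh: "l \<in> carrier G" "h \<in> carrier G"
    \<comment> \<open>With this instance of \<open>eta_shift\<close> the twists match by the cocycle
      identity for \<open>inv k\<close>, \<open>l\<close>, \<open>h\<close>.\<close>
    have 1: "\<eta> (inv (l \<otimes> h)) l = \<eta> l h"
      using eta_shift[of "l \<otimes> h" l] lh by (simp flip: m_assoc)
    have "\<eta> l h * \<eta> (inv k) (l \<otimes> h) = \<eta> (inv (inv l \<otimes> k)) h * \<eta> (inv k) l"
      using eta_cocycle[of "inv k" l h] lh k by (simp add: inv_mult_group mult.commute)
    moreover have "inv l \<otimes> (l \<otimes> h) = h" "inv (l \<otimes> h) \<otimes> k = inv h \<otimes> (inv l \<otimes> k)"
      using lh k by (simp_all add: inv_mult_group m_assoc flip: m_assoc[of "inv l" l h])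
    ultimately show "x (inv (l \<otimes> h) \<otimes> k) * y (inv l \<otimes> (l \<otimes> h)) * z l * \<eta> (inv (l \<otimes> h)) l * \<eta> (inv k) (l \<otimes> h)
      = x (inv h \<otimes> (inv l \<otimes> k)) * y h * \<eta> (inv (inv l \<otimes> k)) h * z l * \<eta> (inv k) l"
      unfolding 1 by (simp add: mult.assoc)
  qed
  also have "\<dots> = (x \<otimes>\<^bsub>A\<^esub> y \<otimes>\<^bsub>A\<^esub> z) k"
    using k by (simp add: twisted_group_algebra_def sum_distrib_left sum_distrib_right mult.assoc)
  finally show "(x \<otimes>\<^bsub>A\<^esub> y \<otimes>\<^bsub>A\<^esub> z) k = (x \<otimes>\<^bsub>A\<^esub> (y \<otimes>\<^bsub>A\<^esub> z)) k" by simp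
qed

text \<open>Only the term \<open>h = k\<close> survives, with weight
  \<open>\<eta> (inv k) k\<close>, which is 1 because the cocycle is equalized. On the other side,
  normalization of the cocycle suffices.\<close>

lemma one_mult:
  assumes "x \<in> carrier A"
  shows "\<one>\<^bsub>A\<^esub> \<otimes>\<^bsub>A\<^esub> x = x"
proof (rule carrier_ext[OF mult_closed assms])
  fix k assume k: "k \<in> carrier G"
  have "(\<one>\<^bsub>A\<^esub> \<otimes>\<^bsub>A\<^esub> x) k = (\<Sum>h\<in>carrier G. if h = k then x h * \<eta> (inv k) h else 0)"
    using k unfolding twisted_group_algebra_def
    by (simp, intro sum.cong) (auto dest: inv_equality simp: inv_solve_left')
  also have "\<dots> = x k" using k finite_carrier by (simp add: eta_inv_left)
  finally show "(\<one>\<^bsub>A\<^esub> \<otimes>\<^bsub>A\<^esub> x) k = x k" .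
qed

lemma mult_one:
  assumes "x \<in> carrier A"
  shows "x \<otimes>\<^bsub>A\<^esub> \<one>\<^bsub>A\<^esub> = x"
proof (rule carrier_ext[OF mult_closed assms])
  fix k assume k: "k \<in> carrier G"
  have "(x \<otimes>\<^bsub>A\<^esub> \<one>\<^bsub>A\<^esub>) k = (\<Sum>h\<in>carrier G. if h = \<one> then x (inv h \<otimes> k) * \<eta> (inv k) h else 0)"
    using k unfolding twisted_group_algebra_def by (auto intro!: sum.cong)
  also have "\<dots> = x k" using k finite_carrier by (simp add: eta_one_right)
  finally show "(x \<otimes>\<^bsub>A\<^esub> \<one>\<^bsub>A\<^esub>) k = x k" .
qed

text \<open>Translating the summation by \<open>k\<close> turns the twist into
  \<open>\<eta> (inv k) (k \<otimes> h)\<close>, the conjugate of \<open>\<eta> k h\<close> by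
  \<open>cnj_eta\<close>.\<close>

lemma star_mult:
  "star A (x \<otimes>\<^bsub>A\<^esub> y) = star A y \<otimes>\<^bsub>A\<^esub> star A x"
proof (rule carrier_ext)
  fix k assume k: "k \<in> carrier G"
  have "(star A y \<otimes>\<^bsub>A\<^esub> star A x) k = (\<Sum>h\<in>carrier G.
      cnj (y (inv (inv h \<otimes> k))) * cnj (x (inv h)) * \<eta> (inv k) h)"
    using k by (simp add: twisted_group_algebra_def)
  also have "\<dots> = (\<Sum>h\<in>carrier G.
      cnj (y (inv (inv (k \<otimes> h) \<otimes> k))) * cnj (x (inv (k \<otimes> h))) * \<eta> (inv k) (k \<otimes> h))"
    using k by (intro sum_translate[symmetric])
  also have "\<dots> = (\<Sum>h\<in>carrier G. cnj (x (inv h \<otimes> inv k) * y h * \<eta> k h))"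
    using k by (intro sum.cong refl)
      (simp add: inv_mult_group cnj_eta m_assoc flip: m_assoc[of "inv k"])
  also have "\<dots> = star A (x \<otimes>\<^bsub>A\<^esub> y) k"
    using k by (simp add: twisted_group_algebra_def)
  finally show "star A (x \<otimes>\<^bsub>A\<^esub> y) k = (star A y \<otimes>\<^bsub>A\<^esub> star A x) k" by simp
qed (simp_all add: twisted_group_algebra_def)

lemma involutive_algebra: "involutive_algebra A"
proof -
  note A_simps = twisted_group_algebra_def PiE_restrict
  have "abelian_group A"
  proof (rule abelian_groupI)
    fix x assume "x \<in> carrier A"
    then show "\<exists>y\<in>carrier A. y \<oplus>\<^bsub>A\<^esub> x = \<zero>\<^bsub>A\<^esub>"
      by (intro bexI[of _ "\<lambda>k\<in>carrier G. - x k"])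
        (simp_all add: A_simps cong: restrict_cong)
  qed (simp_all add: A_simps ac_simps cong: restrict_cong)
  moreover have "monoid A"
    by (rule monoidI) (simp_all add: mult_closed mult_assoc one_mult mult_one,
      simp add: twisted_group_algebra_def)
  ultimately have "ring A"
    by (rule ringI) (simp_all add: A_simps algebra_simps sum.distrib cong: restrict_cong)
  then show ?thesis
    by (rule involutive_algebraI)
      (simp_all add: star_mult, simp_all add: A_simps algebra_simps sum_distrib_left
        cong: restrict_cong)
qed

end

section \<open>The extended intertwiners and their cocycle\<close>

locale inertia_intertwiners =
  normal N G + V?: complex_inner_space scale Basis ip
  for N :: "'g set" and G :: "('g, 'm) monoid_scheme" (structure)
    and scale :: "complex \<Rightarrow> 'v::ab_group_add \<Rightarrow> 'v" and Basis :: "'v set"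
    and ip :: "'v \<Rightarrow> 'v \<Rightarrow> complex" +
  fixes Q :: "'g set" and \<theta> \<Theta> :: "'g \<Rightarrow> 'v \<Rightarrow> 'v"
  assumes finite_carrier: "finite (carrier G)"
    and unitary_rep: "unitary_rep (G\<lparr>carrier := N\<rparr>) scale ip \<theta>"
    and irreducible_rep: "irreducible_rep (G\<lparr>carrier := N\<rparr>) scale \<theta>"
    and Q_subset: "Q \<subseteq> inertia_group G N scale \<theta>"
    and one_in_Q: "\<one> \<in> Q"
    and Q_meets_coset: "h \<in> inertia_group G N scale \<theta> \<Longrightarrow> \<exists>q\<in>Q. q \<in> h <# N"
    and Theta_Q_unitary: "q \<in> Q \<Longrightarrow> unitary_op scale ip (\<Theta> q)"
    and Theta_Q_conj: "\<lbrakk>q \<in> Q; n \<in> N\<rbrakk> \<Longrightarrow>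
      \<theta> (inv q \<otimes> n \<otimes> q) = inv_into UNIV (\<Theta> q) \<circ> \<theta> n \<circ> \<Theta> q"
    and Theta_one: "\<Theta> \<one> = id"
    and Theta_Q_mult: "\<lbrakk>n \<in> N; q \<in> Q\<rbrakk> \<Longrightarrow> \<Theta> (n \<otimes> q) = \<theta> n \<circ> \<Theta> q"
    and eta_equalized: "equalized (inertia_quotient G N scale \<theta>) (eta_of G scale \<Theta>)"
begin

abbreviation I where "I \<equiv> inertia_group G N scale \<theta>"
abbreviation H where "H \<equiv> inertia_quotient G N scale \<theta>"
abbreviation \<tau> where "\<tau> \<equiv> tau_of G scale \<Theta>"
abbreviation \<eta> where "\<eta> \<equiv> eta_of G scale \<Theta>"
abbreviation Theta_inv where "Theta_inv g \<equiv> inv_into UNIV (\<Theta> g)"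

section \<open>Intertwining relations extended from \<open>Q\<close> to the inertia group\<close>

lemma lcos_self: "g \<in> carrier G \<Longrightarrow> g \<in> g <# N"
  by (auto simp: l_coset_def intro!: bexI[of _ \<one>])

lemma I_carrier: "g \<in> I \<Longrightarrow> g \<in> carrier G"
  by (simp add: inertia_group_def)

lemma theta_unitary: "n \<in> N \<Longrightarrow> unitary_op scale ip (\<theta> n)"
  using unitary_rep by (simp add: unitary_rep_def)

lemma theta_mult: "n \<in> N \<Longrightarrow> m \<in> N \<Longrightarrow> \<theta> (n \<otimes> m) v = \<theta> n (\<theta> m v)"
  using unitary_rep by (simp add: unitary_rep_def)

text \<open>\<open>unitary_rep\<close> demands only multiplicativity and unitarity;
  \<open>\<theta> \<one>\<close> is idempotent and injective, hence the identity.\<close>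

lemma theta_one [simp]: "\<theta> \<one> v = v"
proof -
  have "\<theta> \<one> (\<theta> \<one> v) = \<theta> \<one> v" using theta_mult[of \<one> \<one> v] by simp
  then show ?thesis
    using theta_unitary[of \<one>] by (simp add: unitary_op_def bij_is_inj inj_eq)
qed

lemma theta_inv_cancel [simp]:
  assumes "n \<in> N"
  shows "\<theta> n (\<theta> (inv n) v) = v" "\<theta> (inv n) (\<theta> n v) = v"
  using theta_mult[of n "inv n" v] theta_mult[of "inv n" n v] assms by simp_all

text \<open>\<open>Q\<close> represents left cosets, whereas \<open>\<Theta>\<close> is prescribed
  on products with \<open>N\<close> on the left; normality identifies the two kinds of
  coset.\<close>

lemma inertia_decomp:
  assumes "g \<in> I"
  obtains n q where "n \<in> N" "q \<in> Q" "g = n \<otimes> q"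
proof -
  obtain q where q: "q \<in> Q" "q \<in> g <# N" using Q_meets_coset[OF assms] by blast
  then have "g \<in> q <# N"
    using l_coset_swap I_carrier assms subgroup_axioms by blast
  moreover have "q \<in> carrier G" using q Q_subset I_carrier by blast
  ultimately have "g \<in> N #> q" using coset_eq by blast
  then show ?thesis using q that unfolding r_coset_def by blast
qed

lemma Theta_unitary:
  assumes "g \<in> I"
  shows "unitary_op scale ip (\<Theta> g)"
proof -
  obtain n q where nq: "n \<in> N" "q \<in> Q" "g = n \<otimes> q" using assms by (rule inertia_decomp)
  then show ?thesis
    using unitary_op_comp[OF theta_unitary Theta_Q_unitary] by (simp add: Theta_Q_mult)
qed

lemma Theta_inv_right: "g \<in> I \<Longrightarrow> \<Theta> g (Theta_inv g v) = v"
  using Theta_unitary[of g] by (simp add: unitary_op_def bij_is_surj surj_f_inv_f)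

lemma Theta_inv_left: "g \<in> I \<Longrightarrow> Theta_inv g (\<Theta> g v) = v"
  using Theta_unitary[of g] by (simp add: unitary_op_def bij_is_inj inv_f_f)

lemma Theta_inv_unitary: "g \<in> I \<Longrightarrow> unitary_op scale ip (Theta_inv g)"
  by (simp add: Theta_unitary unitary_op_inv)

lemma Theta_eq_0: "g \<in> I \<Longrightarrow> \<Theta> g v = 0 \<longleftrightarrow> v = 0"
  using Theta_inv_left[of g v] Theta_inv_left[of g 0] unitary_op_zero[OF Theta_unitary, of g] by auto

lemma Theta_inv_eq_0: "g \<in> I \<Longrightarrow> Theta_inv g v = 0 \<longleftrightarrow> v = 0"
  using Theta_inv_right[of g v] unitary_op_zero[OF Theta_unitary, of g]
    unitary_op_zero[OF Theta_inv_unitary, of g] by auto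

lemma Theta_left:
  assumes "n \<in> N" "g \<in> I"
  shows "\<Theta> (n \<otimes> g) v = \<theta> n (\<Theta> g v)"
proof -
  obtain m q where mq: "m \<in> N" "q \<in> Q" "g = m \<otimes> q" using assms inertia_decomp by blast
  then have "n \<otimes> g = (n \<otimes> m) \<otimes> q"
    using assms Q_subset I_carrier by (auto simp: m_assoc)
  then show ?thesis using mq assms by (simp add: Theta_Q_mult theta_mult)
qed

text \<open>For \<open>g = m \<otimes> q\<close> the conjugation by \<open>m\<close> stays inside
  \<open>N\<close> and is absorbed by \<open>\<theta>\<close>; what remains is
  \<open>Theta_Q_conj\<close>.\<close>

lemma Theta_intertwines:
  assumes "n \<in> N" "g \<in> I"
  shows "\<theta> n (\<Theta> g v) = \<Theta> g (\<theta> (inv g \<otimes> n \<otimes> g) v)"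
proof -
  obtain m q where mq: "m \<in> N" "q \<in> Q" "g = m \<otimes> q" using assms inertia_decomp by blast
  then have q: "q \<in> I" "q \<in> carrier G" using Q_subset I_carrier by blast+
  let ?k = "inv m \<otimes> n \<otimes> m"
  have k: "?k \<in> N" using mq assms by simp
  have "inv g \<otimes> n \<otimes> g = inv q \<otimes> ?k \<otimes> q"
    using mq q assms by (simp add: inv_mult_group m_assoc)
  then have "\<Theta> g (\<theta> (inv g \<otimes> n \<otimes> g) v) = \<theta> m (\<theta> ?k (\<Theta> q v))"
    using mq q k by (simp add: Theta_Q_mult Theta_Q_conj Theta_inv_right)
  also have "\<dots> = \<theta> (m \<otimes> ?k) (\<Theta> q v)" using mq k by (simp add: theta_mult)
  also have "m \<otimes> ?k = n \<otimes> m" using mq assms by (simp flip: m_assoc)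
  finally show ?thesis using mq assms by (simp add: Theta_Q_mult theta_mult)
qed

text \<open>By normality \<open>g \<otimes> n\<close> is
  \<open>g \<otimes> n \<otimes> inv g\<close> times \<open>g\<close>; \<open>Theta_left\<close>
  applies, and the intertwining relation carries the operator across
  \<open>\<Theta> g\<close>.\<close>

lemma Theta_right:
  assumes "n \<in> N" "g \<in> I"
  shows "\<Theta> (g \<otimes> n) v = \<Theta> g (\<theta> n v)"
proof -
  have g: "g \<in> carrier G" using assms I_carrier by blast
  have n': "g \<otimes> n \<otimes> inv g \<in> N" using g assms by (simp add: inv_op_closed2)
  have "\<Theta> (g \<otimes> n) v = \<Theta> (g \<otimes> n \<otimes> inv g \<otimes> g) v"
    using g assms by (simp add: m_assoc)
  also have "\<dots> = \<Theta> g (\<theta> (inv g \<otimes> (g \<otimes> n \<otimes> inv g) \<otimes> g) v)"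
    using n' assms by (simp add: Theta_left Theta_intertwines)
  also have "inv g \<otimes> (g \<otimes> n \<otimes> inv g) \<otimes> g = n"
    using g assms by (simp add: m_assoc) (simp flip: m_assoc)
  finally show ?thesis .
qed

section \<open>The inertia group is a subgroup containing \<open>N\<close>\<close>

lemma inertiaI:
  assumes g: "g \<in> carrier G" and U: "unitary_op scale ip U"
    and comm: "\<And>n v. n \<in> N \<Longrightarrow> \<theta> n (U v) = U (\<theta> (inv g \<otimes> n \<otimes> g) v)"
  shows "g \<in> I"
  using assms unfolding inertia_group_def equivalent_reps_def conjugate_rep_def unitary_op_def
  by (auto intro!: bexI[of _ U])

text \<open>Unitary intertwiners for the new elements are at hand: the inverse of
  \<open>\<Theta> g\<close> for \<open>inv g\<close>, and
  \<open>\<Theta> g \<circ> \<Theta> h\<close> for the product.\<close>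

lemma I_subgroup: "subgroup I G"
proof (rule subgroupI)
  show "I \<subseteq> carrier G" using I_carrier by blast
  show "I \<noteq> {}" using Q_subset one_in_Q by blast
  fix g assume g: "g \<in> I"
  then have gc: "g \<in> carrier G" by (rule I_carrier)
  show "inv g \<in> I"
  proof (rule inertiaI[OF _ Theta_inv_unitary[OF g]])
    fix n v assume n: "n \<in> N"
    \<comment> \<open>The relation for \<open>g\<close> is used at this element, which conjugates
      back to \<open>n\<close>.\<close>
    have gn: "g \<otimes> n \<otimes> inv g \<in> N" using gc n by (simp add: inv_op_closed2)
    have *: "inv g \<otimes> (g \<otimes> n \<otimes> inv g) \<otimes> g = n"
      using gc n by (simp add: m_assoc) (simp flip: m_assoc)
    have "\<theta> (g \<otimes> n \<otimes> inv g) v = \<Theta> g (\<theta> n (Theta_inv g v))"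
      using Theta_intertwines[OF gn g, of "Theta_inv g v"] g by (simp add: Theta_inv_right *)
    then show "\<theta> n (Theta_inv g v) = Theta_inv g (\<theta> (inv (inv g) \<otimes> n \<otimes> inv g) v)"
      using g gc by (simp add: Theta_inv_left)
  qed (use gc in simp)
  fix h assume h: "h \<in> I"
  then have hc: "h \<in> carrier G" by (rule I_carrier)
  show "g \<otimes> h \<in> I"
  proof (rule inertiaI[OF _ unitary_op_comp[OF Theta_unitary[OF g] Theta_unitary[OF h]]])
    fix n v assume n: "n \<in> N"
    have "inv g \<otimes> n \<otimes> g \<in> N" using n gc by (simp add: inv_op_closed1)
    then show "\<theta> n ((\<Theta> g \<circ> \<Theta> h) v) = (\<Theta> g \<circ> \<Theta> h) (\<theta> (inv (g \<otimes> h) \<otimes> n \<otimes> (g \<otimes> h)) v)"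
      using n g h gc hc by (simp add: Theta_intertwines inv_mult_group m_assoc)
  qed (use gc hc in simp)
qed

sublocale I: subgroup I G by (rule I_subgroup)

lemma N_subset_I:
  assumes n: "n \<in> N"
  shows "n \<in> I"
proof (rule inertiaI[OF _ theta_unitary[OF n]])
  fix m v assume m: "m \<in> N"
  have "n \<otimes> (inv n \<otimes> m \<otimes> n) = m \<otimes> n" using n m by (simp flip: m_assoc)
  then show "\<theta> m (\<theta> n v) = \<theta> n (\<theta> (inv n \<otimes> m \<otimes> n) v)"
    using n m by (simp flip: theta_mult)
qed (use n in simp)

lemma V_nonzero: obtains v :: 'v where "v \<noteq> 0"
  using irreducible_rep unfolding irreducible_rep_def by auto

section \<open>The scalars \<open>\<tau>\<close> and the function \<open>\<eta>\<close> on
  cosets\<close>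

lemma commutant_scalar:
  assumes "T \<in> End_space scale" and "\<And>n v. n \<in> N \<Longrightarrow> T (\<theta> n v) = \<theta> n (T v)"
  obtains c where "T = scale c"
  using schur_scalar[OF irreducible_rep _ assms(1)] assms(2) theta_unitary
  by (auto simp: unitary_op_def)

text \<open>\<open>\<Theta> (k \<otimes> h)\<close> and \<open>\<Theta> k \<circ> \<Theta> h\<close>
  satisfy the same intertwining relation, so their quotient commutes with \<open>\<theta>\<close>
  and is a scalar by Schur; unitarity forces modulus one, and a nonzero vector gives
  uniqueness.\<close>

lemma tau_exists:
  assumes k: "k \<in> I" and h: "h \<in> I"
  shows "\<exists>!c. cmod c = 1 \<and> \<Theta> (k \<otimes> h) = (\<lambda>v. scale c (\<Theta> k (\<Theta> h v)))"
proof -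
  have c: "k \<in> carrier G" "h \<in> carrier G" using k h I_carrier by auto
  have kh: "k \<otimes> h \<in> I" using k h by simp
  define U where "U = \<Theta> k \<circ> \<Theta> h"
  have U: "unitary_op scale ip U"
    unfolding U_def by (intro unitary_op_comp Theta_unitary k h)
  have UN: "\<theta> n (U v) = U (\<theta> (inv (k \<otimes> h) \<otimes> n \<otimes> (k \<otimes> h)) v)" if "n \<in> N" for n v
  proof -
    have "inv k \<otimes> n \<otimes> k \<in> N" using that c by (simp add: inv_op_closed1)
    then show ?thesis using that k h c
      by (simp add: U_def Theta_intertwines inv_mult_group m_assoc)
  qed
  have [simp]: "U (inv_into UNIV U v) = v" "inv_into UNIV U (U v) = v" for v
    using U by (simp_all add: unitary_op_def bij_is_surj surj_f_inv_f bij_is_inj)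
  let ?T = "\<Theta> (k \<otimes> h) \<circ> inv_into UNIV U"
  have T: "unitary_op scale ip ?T"
    using U kh by (intro unitary_op_comp Theta_unitary unitary_op_inv)
  have "?T (\<theta> n v) = \<theta> n (?T v)" if "n \<in> N" for n v
  proof -
    let ?n = "inv (k \<otimes> h) \<otimes> n \<otimes> (k \<otimes> h)"
    have "\<theta> n v = U (\<theta> ?n (inv_into UNIV U v))" using UN[OF that, of "inv_into UNIV U v"] by simp
    then have "?T (\<theta> n v) = \<Theta> (k \<otimes> h) (\<theta> ?n (inv_into UNIV U v))" by simp
    also have "\<dots> = \<theta> n (?T v)" using Theta_intertwines[OF that kh] by simp
    finally show ?thesis .
  qed
  then obtain c where c: "?T = scale c"
    using T commutant_scalar[of ?T] unfolding unitary_op_def by blast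
  have *: "\<Theta> (k \<otimes> h) v = scale c (\<Theta> k (\<Theta> h v))" for v
  proof -
    have "\<Theta> (k \<otimes> h) v = scale c (U v)" using fun_cong[OF c, of "U v"] by simp
    then show ?thesis by (simp add: U_def)
  qed
  obtain v :: 'v where v: "v \<noteq> 0" by (rule V_nonzero)
  \<comment> \<open>The scalar operator is \<open>?T\<close>, hence preserves the inner product;
    this yields c times its conjugate equal to 1.\<close>
  have "ip (scale c v) (scale c v) = ip v v"
    using T unfolding unitary_op_def c by blast
  then have "c * cnj c * ip v v = ip v v"
    by (simp only: ip_scale_left ip_scale_right ac_simps)
  moreover have "ip v v \<noteq> 0" using ip_pos[OF v] by auto
  ultimately have "complex_of_real ((cmod c)\<^sup>2) = of_real 1"
    by (simp only: complex_norm_square) (simp add: mult.commute)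
  then have "(cmod c)\<^sup>2 = 1" by (simp only: of_real_eq_iff)
  then have "cmod c = 1" using norm_ge_zero[of c] by (auto simp: power2_eq_1_iff)
  moreover have "\<Theta> (k \<otimes> h) = (\<lambda>v. scale c (\<Theta> k (\<Theta> h v)))"
    using * by (rule ext)
  moreover have "d = c" if "\<Theta> (k \<otimes> h) = (\<lambda>v. scale d (\<Theta> k (\<Theta> h v)))" for d
  proof -
    have "scale d (\<Theta> k (\<Theta> h v)) = scale c (\<Theta> k (\<Theta> h v))"
      using *[of v] by (simp only: that)
    then show ?thesis using v k h by (simp add: Theta_eq_0)
  qed
  ultimately show ?thesis by (intro ex1I[of _ c]) (rule conjI, blast+)
qed

lemma tau_unit: "k \<in> I \<Longrightarrow> h \<in> I \<Longrightarrow> cmod (\<tau> k h) = 1"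
  using theI'[OF tau_exists] unfolding tau_of_def by blast

lemma Theta_mult: "k \<in> I \<Longrightarrow> h \<in> I \<Longrightarrow> \<Theta> (k \<otimes> h) v = scale (\<tau> k h) (\<Theta> k (\<Theta> h v))"
  using theI'[OF tau_exists, of k h] unfolding tau_of_def by (auto dest: fun_cong)

text \<open>Existence being settled, a single nonzero vector determines the scalar.\<close>

lemma tau_eqI:
  assumes "k \<in> I" "h \<in> I" "v \<noteq> 0" "\<Theta> (k \<otimes> h) v = scale c (\<Theta> k (\<Theta> h v))"
  shows "\<tau> k h = c"
  using assms Theta_mult[of k h v] by (simp add: Theta_eq_0)

text \<open>Moving \<open>n\<close> across \<open>h\<close> replaces it by
  \<open>inv h \<otimes> n \<otimes> h\<close> in \<open>N\<close>; \<open>Theta_right\<close> and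
  the intertwining relation then produce the same \<open>\<theta>\<close> factors on both
  sides.\<close>

lemma tau_coset:
  assumes k: "k \<in> I" and h: "h \<in> I" and n: "n \<in> N" and m: "m \<in> N"
  shows "\<tau> (k \<otimes> n) (h \<otimes> m) = \<tau> k h"
proof -
  have c: "k \<in> carrier G" "h \<in> carrier G" using k h I_carrier by auto
  obtain v :: 'v where v: "v \<noteq> 0" by (rule V_nonzero)
  let ?n = "inv h \<otimes> n \<otimes> h"
  have n': "?n \<in> N" using c n by (simp add: inv_op_closed1)
  have "k \<otimes> n \<otimes> (h \<otimes> m) = k \<otimes> h \<otimes> (?n \<otimes> m)"
    using c n m by (simp add: m_assoc) (simp flip: m_assoc)
  then have "\<Theta> (k \<otimes> n \<otimes> (h \<otimes> m)) v = \<Theta> (k \<otimes> h) (\<theta> ?n (\<theta> m v))"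
    using k h n' m by (simp add: Theta_right theta_mult)
  also have "\<dots> = scale (\<tau> k h) (\<Theta> k (\<theta> n (\<Theta> h (\<theta> m v))))"
    using k h n m by (simp add: Theta_mult Theta_intertwines)
  also have "\<dots> = scale (\<tau> k h) (\<Theta> (k \<otimes> n) (\<Theta> (h \<otimes> m) v))"
    using k h n m by (simp add: Theta_right)
  finally show ?thesis
    using k h n m v N_subset_I by (intro tau_eqI) auto
qed

text \<open>Evaluates the definite description: \<open>\<tau>\<close> is constant on pairs of
  cosets, and cosets are nonempty.\<close>

lemma eta_coset:
  assumes "k \<in> I" "h \<in> I"
  shows "\<eta> (k <# N) (h <# N) = \<tau> k h"
  unfolding eta_of_def
proof (rule the_equality)
  show "\<forall>x\<in>k <# N. \<forall>y\<in>h <# N. \<tau> x y = \<tau> k h"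
    using assms by (auto simp: l_coset_def tau_coset)
  fix c assume "\<forall>x\<in>k <# N. \<forall>y\<in>h <# N. \<tau> x y = c"
  moreover have "k \<in> k <# N" "h \<in> h <# N"
    using assms I_carrier lcos_self by auto
  ultimately show "c = \<tau> k h" by auto
qed

section \<open>The quotient of the inertia group\<close>

text \<open>These rules would rewrite products in \<open>H\<close> to set products, on which \<open>H_mult\<close> does not fire.\<close>

declare mult_FactGroup [simp del] one_FactGroup [simp del] carrier_FactGroup [simp del]

lemma N_normal_I: "N \<lhd> G\<lparr>carrier := I\<rparr>"
  by (rule normal_restrict_supergroup[OF I_subgroup normal_axioms]) (use N_subset_I in blast)

lemma H_group: "group H"
  by (rule normal.factorgroup_is_group[OF N_normal_I])

text \<open>The quotient is built from right cosets, whereas \<open>\<Phi>\<close> evaluates at left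
  cosets; normality reconciles them.\<close>

lemma carrier_H: "carrier H = (\<lambda>g. g <# N) ` I"
proof -
  have "carrier H = (\<lambda>g. N #> g) ` I"
    by (auto simp: FactGroup_def RCOSETS_def r_coset_def)
  also have "\<dots> = (\<lambda>g. g <# N) ` I"
    using coset_eq I_carrier by (intro image_cong) auto
  finally show ?thesis .
qed

lemma coset_in_H: "g \<in> I \<Longrightarrow> g <# N \<in> carrier H"
  by (simp add: carrier_H)

lemma H_mult: "\<lbrakk>g \<in> I; h \<in> I\<rbrakk> \<Longrightarrow> (g <# N) \<otimes>\<^bsub>H\<^esub> (h <# N) = (g \<otimes> h) <# N"
  using rcos_sum[of g h] coset_eq I_carrier by (simp add: FactGroup_def set_mult_def)

lemma H_one: "\<one>\<^bsub>H\<^esub> = \<one> <# N"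
  by (simp add: FactGroup_def lcos_mult_one subset)

lemma H_inv: "g \<in> I \<Longrightarrow> inv\<^bsub>H\<^esub> (g <# N) = inv g <# N"
  using I_carrier
  by (intro group.inv_equality[OF H_group]) (simp_all add: H_mult H_one coset_in_H)

lemma coset_eq_N_iff:
  assumes "g \<in> carrier G"
  shows "g <# N = N \<longleftrightarrow> g \<in> N"
proof
  assume "g <# N = N"
  then show "g \<in> N" using lcos_self[OF assms] by simp
next
  assume "g \<in> N"
  then show "g <# N = N"
    using l_repr_independence[OF _ one_closed subgroup_axioms, of g]
    by (simp add: lcos_mult_one subset)
qed

lemma card_N_pos: "card N > 0"
  using finite_subset[OF subset finite_carrier] subgroup.one_closed[OF subgroup_axioms]
  by (metis card_gt_0_iff empty_iff)

text \<open>Each fibre of \<open>g \<mapsto> g <# N\<close> is a coset with \<open>card N\<close>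
  elements. This factor is what the normalization by 1/|N| in \<open>\<Phi>\<close>
  compensates.\<close>

lemma sum_inertia_cosets: "(\<Sum>g\<in>I. F (g <# N)) = of_nat (card N) * (\<Sum>A\<in>carrier H. F A :: complex)"
proof -
  have fin: "finite I" using finite_carrier I.subset finite_subset by blast
  have "(\<Sum>g\<in>I. F (g <# N)) = (\<Sum>A\<in>carrier H. \<Sum>g\<in>{g \<in> I. g <# N = A}. F (g <# N))"
    by (rule sum.group[symmetric]) (auto simp: carrier_H fin)
  also have "\<dots> = (\<Sum>A\<in>carrier H. of_nat (card N) * F A)"
  proof (rule sum.cong[OF refl])
    fix A assume "A \<in> carrier H"
    then obtain k where k: "k \<in> I" "A = k <# N" by (auto simp: carrier_H)
    have kc: "k \<in> carrier G" using k I_carrier by blast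
    have "{g \<in> I. g <# N = A} = (\<lambda>n. k \<otimes> n) ` N"
    proof
      show "{g \<in> I. g <# N = A} \<subseteq> (\<otimes>) k ` N"
      proof
        fix g assume g: "g \<in> {g \<in> I. g <# N = A}"
        then have "g \<in> g <# N" using I_carrier lcos_self by auto
        then show "g \<in> (\<otimes>) k ` N" using g k by (auto simp: l_coset_def)
      qed
      show "(\<otimes>) k ` N \<subseteq> {g \<in> I. g <# N = A}"
      proof
        fix g assume g: "g \<in> (\<otimes>) k ` N"
        then have "g \<in> k <# N" by (auto simp: l_coset_def)
        then have "k <# N = g <# N" by (rule l_repr_independence[OF _ kc subgroup_axioms])
        then show "g \<in> {g \<in> I. g <# N = A}" using g k N_subset_I by auto
      qed
    qed
    moreover have "inj_on ((\<otimes>) k) N" using kc by (intro inj_onI) simp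
    ultimately have "card {g \<in> I. g <# N = A} = card N" by (simp add: card_image)
    then show "(\<Sum>g\<in>{g \<in> I. g <# N = A}. F (g <# N)) = of_nat (card N) * F A" by simp
  qed
  finally show ?thesis by (simp add: sum_distrib_left)
qed

text \<open>The cocycle identity is associativity in \<open>G\<close>: \<open>\<Theta>\<close> of a
  triple product is expanded in two ways and compared at a nonzero vector.\<close>

sublocale H: equalized_unitary_cocycle H \<eta>
proof (intro equalized_unitary_cocycle.intro equalized_unitary_cocycle_axioms.intro H_group)
  obtain v :: 'v where v: "v \<noteq> 0" by (rule V_nonzero)
  show "finite (carrier H)"
    unfolding carrier_H using finite_subset[OF I.subset finite_carrier] by (rule finite_imageI)
  show "equalized H \<eta>" by (rule eta_equalized)
  fix x assume x: "x \<in> carrier H"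
  then obtain k where k: "k \<in> I" "x = k <# N" by (auto simp: carrier_H)
  then have kc: "k \<in> carrier G" using I_carrier by blast
  show "\<eta> \<one>\<^bsub>H\<^esub> x = 1"
    unfolding H_one k using k kc v by (simp add: eta_coset) (intro tau_eqI, auto simp: Theta_one)
  show "\<eta> x \<one>\<^bsub>H\<^esub> = 1"
    unfolding H_one k using k kc v by (simp add: eta_coset) (intro tau_eqI, auto simp: Theta_one)
  fix y assume y: "y \<in> carrier H"
  then obtain h where h: "h \<in> I" "y = h <# N" by (auto simp: carrier_H)
  then have hc: "h \<in> carrier G" using I_carrier by blast
  show "cmod (\<eta> x y) = 1" using k h by (simp add: eta_coset tau_unit)
  fix z assume z: "z \<in> carrier H"
  then obtain l where l: "l \<in> I" "z = l <# N" by (auto simp: carrier_H)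
  then have lc: "l \<in> carrier G" using I_carrier by blast
  let ?w = "\<Theta> k (\<Theta> h (\<Theta> l v))"
  have "scale (\<tau> (k \<otimes> h) l * \<tau> k h) ?w = \<Theta> (k \<otimes> h \<otimes> l) v"
    using k h l by (simp add: Theta_mult)
  also have "\<dots> = \<Theta> (k \<otimes> (h \<otimes> l)) v" using kc hc lc by (simp add: m_assoc)
  also have "\<dots> = scale (\<tau> k (h \<otimes> l) * \<tau> h l) ?w"
    using k h l by (simp add: Theta_mult unitary_op_scale[OF Theta_unitary])
  finally have "\<tau> (k \<otimes> h) l * \<tau> k h = \<tau> k (h \<otimes> l) * \<tau> h l"
    using v k h l by (simp add: Theta_eq_0)
  then show "\<eta> (x \<otimes>\<^bsub>H\<^esub> y) z * \<eta> x y = \<eta> x (y \<otimes>\<^bsub>H\<^esub> z) * \<eta> y z"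
    using k h l by (simp add: H_mult eta_coset)
qed

end

section \<open>The isomorphism\<close>

context inertia_intertwiners
begin

abbreviation L where "L \<equiv> twisted_group_algebra H \<eta>"
abbreviation HA where "HA \<equiv> hecke_algebra G N scale Basis ip \<theta>"
abbreviation \<Phi> where "\<Phi> \<equiv> Phi_map G N scale ip \<theta> \<Theta>"

lemma Phi_inertia:
  "g \<in> I \<Longrightarrow> \<Phi> f g = (\<lambda>v. scale (1 / of_nat (card N) * f (g <# N)) (Theta_inv g v))"
  by (simp add: Phi_map_def I_carrier adjoint_op_unitary Theta_unitary)

lemma Phi_outside: "g \<in> carrier G \<Longrightarrow> g \<notin> I \<Longrightarrow> \<Phi> f g = (\<lambda>v. 0)"
  by (simp add: Phi_map_def)

lemma Phi_extensional: "\<Phi> f \<in> extensional (carrier G)"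
  by (simp add: Phi_map_def)

text \<open>Used backwards for every operation: the Hecke algebra side is computed pointwise and
  recognized as an image under \<open>\<Phi>\<close>.\<close>

lemma Phi_eqI:
  assumes "F \<in> extensional (carrier G)"
    and "\<And>g v. g \<in> I \<Longrightarrow> F g v = scale (1 / of_nat (card N) * f (g <# N)) (Theta_inv g v)"
    and "\<And>g v. g \<in> carrier G \<Longrightarrow> g \<notin> I \<Longrightarrow> F g v = 0"
  shows "F = \<Phi> f"
proof (rule extensionalityI[OF assms(1) Phi_extensional])
  fix g assume "g \<in> carrier G"
  then show "F g = \<Phi> f g"
    using assms(2,3) by (cases "g \<in> I") (auto simp: Phi_inertia Phi_outside)
qed

section \<open>Covariance of the functions \<open>\<Phi> f\<close>\<close>

lemma theta_inv_eq: "n \<in> N \<Longrightarrow> inv_into UNIV (\<theta> n) v = \<theta> (inv n) v"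
  using theta_unitary[of n] by (intro inv_f_eq) (auto simp: unitary_op_def bij_is_inj)

lemma Theta_N: "n \<in> N \<Longrightarrow> \<Theta> n = \<theta> n"
  using Theta_Q_mult[OF _ one_in_Q] by (simp add: Theta_one)

lemma Theta_inv_eqI: "g \<in> I \<Longrightarrow> \<Theta> g w = v \<Longrightarrow> Theta_inv g v = w"
  using Theta_inv_left by blast

lemma Theta_inv_N: "n \<in> N \<Longrightarrow> Theta_inv n v = \<theta> (inv n) v"
  by (simp add: Theta_N theta_inv_eq)

lemma Theta_inv_left_N:
  "n \<in> N \<Longrightarrow> g \<in> I \<Longrightarrow> Theta_inv (n \<otimes> g) v = Theta_inv g (\<theta> (inv n) v)"
  by (rule Theta_inv_eqI) (simp_all add: N_subset_I Theta_left Theta_inv_right)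

lemma Theta_inv_right_N:
  "n \<in> N \<Longrightarrow> g \<in> I \<Longrightarrow> Theta_inv (g \<otimes> n) v = \<theta> (inv n) (Theta_inv g v)"
  by (rule Theta_inv_eqI) (simp_all add: N_subset_I Theta_right Theta_inv_right)

lemma lcoset_mult_N:
  assumes "g \<in> carrier G" "n \<in> N" "m \<in> N"
  shows "(n \<otimes> g \<otimes> m) <# N = g <# N"
proof -
  have "n \<otimes> g \<otimes> m = g \<otimes> (inv g \<otimes> n \<otimes> g \<otimes> m)"
    using assms by (simp add: m_assoc) (simp flip: m_assoc)
  moreover have "inv g \<otimes> n \<otimes> g \<otimes> m \<in> N" using assms by (simp add: inv_op_closed1)
  ultimately have "n \<otimes> g \<otimes> m \<in> g <# N" by (auto simp: l_coset_def)
  then show ?thesis using l_repr_independence assms subgroup_axioms by metis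
qed

lemma inertia_mult_N_iff:
  assumes g: "g \<in> carrier G" and n: "n \<in> N" and m: "m \<in> N"
  shows "n \<otimes> g \<otimes> m \<in> I \<longleftrightarrow> g \<in> I"
proof
  assume "n \<otimes> g \<otimes> m \<in> I"
  then have "inv n \<otimes> (n \<otimes> g \<otimes> m) \<otimes> inv m \<in> I" using n m N_subset_I by simp
  also have "inv n \<otimes> (n \<otimes> g \<otimes> m) \<otimes> inv m = g"
    using g n m by (simp add: m_assoc) (simp flip: m_assoc)
  finally show "g \<in> I" .
qed (use n m N_subset_I in simp)

text \<open>On the inertia group covariance comes from the inverses of \<open>\<Theta>\<close>,
  since the scalar is constant on cosets; off it, both sides vanish because multiplying by elements
  of \<open>N\<close> on either side does not lead into the inertia group.\<close>

lemma Phi_in_HA: "\<Phi> f \<in> carrier HA"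
proof -
  have E: "\<Phi> f g \<in> End_space scale" if "g \<in> carrier G" for g
  proof (cases "g \<in> I")
    case True
    then show ?thesis by (simp add: Phi_inertia scale_unitary_in_End Theta_inv_unitary)
  next
    case False
    then show ?thesis
      using scale_unitary_in_End[OF unitary_op_id, of 0] that by (simp add: Phi_outside)
  qed
  have "\<Phi> f (n \<otimes> g \<otimes> m) v = \<theta> (inv m) (\<Phi> f g (\<theta> (inv n) v))"
    if g: "g \<in> carrier G" and n: "n \<in> N" and m: "m \<in> N" for g n m v
  proof (cases "g \<in> I")
    case True
    then show ?thesis
      using g n m inertia_mult_N_iff[OF g n m] N_subset_I
      by (simp add: Phi_inertia lcoset_mult_N Theta_inv_left_N Theta_inv_right_N
          unitary_op_scale[OF theta_unitary])
  next
    case False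
    then show ?thesis
      using g n m inertia_mult_N_iff[OF g n m]
      by (simp add: Phi_outside unitary_op_zero[OF theta_unitary])
  qed
  then show ?thesis
    using E Phi_extensional[of f] by (auto simp: hecke_algebra_def PiE_def fun_eq_iff)
qed

section \<open>Shape of the elements of the Hecke algebra; bijectivity of
  \<open>\<Phi>\<close>\<close>

lemma
  assumes "F \<in> carrier HA" "g \<in> carrier G"
  shows HA_linear: "F g \<in> End_space scale"
    and HA_mult_right: "m \<in> N \<Longrightarrow> F (g \<otimes> m) v = \<theta> (inv m) (F g v)"
    and HA_intertwines: "n \<in> N \<Longrightarrow> F g (\<theta> n v) = \<theta> (inv g \<otimes> n \<otimes> g) (F g v)"
proof -
  have cov: "F (n \<otimes> g \<otimes> m) v = \<theta> (inv m) (F g (\<theta> (inv n) v))" if "n \<in> N" "m \<in> N" for n m v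
    using assms that by (simp add: hecke_algebra_def)
  show "F g \<in> End_space scale" using assms by (auto simp: hecke_algebra_def)
  show right: "F (g \<otimes> m) v = \<theta> (inv m) (F g v)" if "m \<in> N" for m v
    using cov[of \<one> m] assms that by simp
  assume n: "n \<in> N"
  then have n': "inv g \<otimes> n \<otimes> g \<in> N" "inv (inv g \<otimes> n \<otimes> g) \<in> N"
    using assms by (simp_all add: inv_op_closed1)
  \<comment> \<open>Normality turns left translation by \<open>inv n\<close> into right translation
    by an element of \<open>N\<close>, for which covariance acts after \<open>F g\<close> instead of
    before it.\<close>
  have "F g (\<theta> n v) = F (inv n \<otimes> g) v"
    using cov[of "inv n" \<one> v] n assms by simp
  also have "inv n \<otimes> g = g \<otimes> inv (inv g \<otimes> n \<otimes> g)"
    using n assms by (simp add: inv_mult_group m_assoc) (simp flip: m_assoc)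
  also have "F \<dots> v = \<theta> (inv g \<otimes> n \<otimes> g) (F g v)"
    using right[OF n'(2)] n' by simp
  finally show "F g (\<theta> n v) = \<theta> (inv g \<otimes> n \<otimes> g) (F g v)" .
qed

text \<open>A nonzero \<open>F g\<close> would be bijective by Schur, and its inverse an equivalence
  from the conjugate representation to \<open>\<theta>\<close>, which puts \<open>g\<close> into the
  inertia group.\<close>

lemma HA_outside:
  assumes F: "F \<in> carrier HA" and g: "g \<in> carrier G" and nI: "g \<notin> I"
  shows "F g = (\<lambda>v. 0)"
proof (rule ccontr)
  assume nz: "F g \<noteq> (\<lambda>v. 0)"
  have b: "bij (F g)"
  proof (rule schur_bij[OF irreducible_rep HA_linear[OF F g] nz])
    fix n v assume "n \<in> carrier (G\<lparr>carrier := N\<rparr>)"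
    then have n: "n \<in> N" by simp
    then show "F g (\<theta> n v) = \<theta> (inv g \<otimes> n \<otimes> g) (F g v)" by (rule HA_intertwines[OF F g])
    show "\<theta> (inv g \<otimes> n \<otimes> g) 0 = 0"
      using n g by (intro unitary_op_zero theta_unitary inv_op_closed1)
  qed
  let ?T = "inv_into UNIV (F g)"
  interpret Fg: Vector_Spaces.linear scale scale "F g"
    using HA_linear[OF F g] by (simp add: End_space_def)
  have r: "F g (?T v) = v" for v using b by (simp add: bij_is_surj surj_f_inv_f)
  have eq: "?T v = w" if "v = F g w" for v w using b that by (simp add: bij_is_inj)
  have "Vector_Spaces.linear scale scale ?T"
    by unfold_locales (auto intro!: eq simp: Fg.add Fg.scale r)
  moreover have "?T (\<theta> (inv g \<otimes> n \<otimes> g) v) = \<theta> n (?T v)" if "n \<in> N" for n v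
    using that by (intro eq) (simp add: HA_intertwines[OF F g] r)
  ultimately have "g \<in> I"
    using b g unfolding inertia_group_def equivalent_reps_def conjugate_rep_def End_space_def
    by (auto intro!: exI[of _ ?T] simp: bij_imp_bij_inv fun_eq_iff)
  then show False using nI by simp
qed

text \<open>The two intertwining relations cancel, so \<open>\<Theta> g \<circ> F g\<close> commutes
  with \<open>\<theta>\<close> and is a scalar.\<close>

lemma HA_inertia:
  assumes F: "F \<in> carrier HA" and g: "g \<in> I"
  obtains c where "\<And>v. F g v = scale (1 / of_nat (card N) * c) (Theta_inv g v)"
proof -
  have gc: "g \<in> carrier G" using g by (rule I_carrier)
  have "\<Theta> g \<circ> F g \<in> End_space scale"
    using HA_linear[OF F gc] Theta_unitary[OF g] unfolding unitary_op_def End_space_def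
    by (auto intro: Vector_Spaces.linear_compose)
  moreover have "(\<Theta> g \<circ> F g) (\<theta> n v) = \<theta> n ((\<Theta> g \<circ> F g) v)" if "n \<in> N" for n v
    using that g gc by (simp add: HA_intertwines[OF F gc] Theta_intertwines)
  ultimately obtain c where c: "\<Theta> g \<circ> F g = scale c" by (rule commutant_scalar)
  have "F g v = Theta_inv g (scale c v)" for v
    using fun_cong[OF c, of v] Theta_inv_left[OF g, of "F g v"] by simp
  \<comment> \<open>The factor \<open>card N\<close> is inserted so that the constant is the value
    required of f.\<close>
  then have "F g v = scale (1 / of_nat (card N) * (of_nat (card N) * c)) (Theta_inv g v)" for v
    using card_N_pos by (simp add: unitary_op_scale[OF Theta_inv_unitary[OF g]])
  then show ?thesis by (rule that)
qed

text \<open>Passing from \<open>k\<close> to \<open>k \<otimes> n\<close> multiplies both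
  \<open>F\<close> and the inverse of \<open>\<Theta>\<close> by \<open>\<theta> (inv n)\<close>, so
  one constant serves a whole coset.\<close>

lemma Phi_surj:
  assumes F: "F \<in> carrier HA"
  obtains f where "f \<in> carrier L" "F = \<Phi> f"
proof -
  have ex: "\<exists>c. \<forall>g\<in>I. g <# N = A \<longrightarrow>
      (\<forall>v. F g v = scale (1 / of_nat (card N) * c) (Theta_inv g v))" if A: "A \<in> carrier H" for A
  proof -
    obtain k where k: "k \<in> I" "A = k <# N" using A by (auto simp: carrier_H)
    obtain c where c: "\<And>v. F k v = scale (1 / of_nat (card N) * c) (Theta_inv k v)"
      using HA_inertia[OF F k(1)] by blast
    have "F g v = scale (1 / of_nat (card N) * c) (Theta_inv g v)" if g: "g \<in> I" "g <# N = A" for g v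
    proof -
      have "g \<in> k <# N" using g k lcos_self I_carrier by blast
      then obtain n where n: "n \<in> N" "g = k \<otimes> n" by (auto simp: l_coset_def)
      then show ?thesis
        using k HA_mult_right[OF F I_carrier[OF k(1)] n(1), of v]
        by (simp add: c Theta_inv_right_N unitary_op_scale[OF theta_unitary])
    qed
    then show ?thesis by blast
  qed
  \<comment> \<open>One such constant is chosen per coset; the restriction makes \<open>f\<close>
    extensional, as \<open>carrier L\<close> demands.\<close>
  define f where "f = (\<lambda>A\<in>carrier H. SOME c. \<forall>g\<in>I. g <# N = A \<longrightarrow>
      (\<forall>v. F g v = scale (1 / of_nat (card N) * c) (Theta_inv g v)))"
  show ?thesis
  proof (rule that)
    show "f \<in> carrier L" by (simp add: f_def twisted_group_algebra_def)
    show "F = \<Phi> f"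
    proof (rule Phi_eqI)
      show "F \<in> extensional (carrier G)" using F by (auto simp: hecke_algebra_def PiE_def)
      fix g v assume "g \<in> I"
      then show "F g v = scale (1 / of_nat (card N) * f (g <# N)) (Theta_inv g v)"
        using someI_ex[OF ex[OF coset_in_H[of g]]] coset_in_H[of g] by (simp add: f_def)
    qed (simp add: HA_outside[OF F])
  qed
qed

lemma Phi_inj: "inj_on \<Phi> (carrier L)"
proof (rule inj_onI)
  fix f f' assume f: "f \<in> carrier L" "f' \<in> carrier L" and eq: "\<Phi> f = \<Phi> f'"
  obtain v :: 'v where v: "v \<noteq> 0" by (rule V_nonzero)
  show "f = f'"
  proof (rule H.carrier_ext[OF f])
    fix A assume "A \<in> carrier H"
    then obtain g where g: "g \<in> I" "A = g <# N" by (auto simp: carrier_H)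
    have "\<Phi> f g v = \<Phi> f' g v" using eq by simp
    then show "f A = f' A" using g v card_N_pos by (simp add: Phi_inertia Theta_inv_eq_0)
  qed
qed

lemma Phi_image: "carrier HA = \<Phi> ` carrier L"
  using Phi_in_HA Phi_surj by blast

section \<open>Compatibility of \<open>\<Phi>\<close> with the algebra operations\<close>

lemma Theta_inv_mult:
  assumes "k \<in> I" "h \<in> I"
  shows "Theta_inv h (Theta_inv k v) = scale (\<tau> k h) (Theta_inv (k \<otimes> h) v)"
proof -
  let ?w = "Theta_inv (k \<otimes> h) v"
  have "v = \<Theta> (k \<otimes> h) ?w" using assms by (simp add: Theta_inv_right)
  \<comment> \<open>The scalar is moved onto \<open>?w\<close>, so stripping off the two operators
    leaves \<open>\<tau> k h\<close> itself and not its conjugate.\<close>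
  also have "\<dots> = \<Theta> k (\<Theta> h (scale (\<tau> k h) ?w))"
    using assms by (simp add: Theta_mult unitary_op_scale[OF Theta_unitary])
  finally show ?thesis using assms by (metis Theta_inv_left)
qed

text \<open>Composing the values at \<open>inv h \<otimes> g\<close> and \<open>h\<close> gives a
  multiple of the inverse of \<open>\<Theta> g\<close> that depends only on the coset of
  \<open>h\<close>, so the convolution over the group collapses to one over the quotient.\<close>

lemma Phi_mult: "\<Phi> (f \<otimes>\<^bsub>L\<^esub> f') = \<Phi> f \<otimes>\<^bsub>HA\<^esub> \<Phi> f'"
proof (rule Phi_eqI[symmetric])
  show "\<Phi> f \<otimes>\<^bsub>HA\<^esub> \<Phi> f' \<in> extensional (carrier G)" by (simp add: hecke_algebra_def)
  \<comment> \<open>Terms with \<open>h\<close> outside the inertia group drop out: the inner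
    operator is zero and the outer one, being linear, fixes 0.\<close>
  have prod: "(\<Phi> f \<otimes>\<^bsub>HA\<^esub> \<Phi> f') g v = (\<Sum>h\<in>I. \<Phi> f (inv h \<otimes> g) (\<Phi> f' h v))"
    if g: "g \<in> carrier G" for g v
  proof -
    have "\<Phi> f (inv h \<otimes> g) 0 = 0" if "h \<in> carrier G" for h
    proof -
      have "\<Phi> f (inv h \<otimes> g) \<in> End_space scale" using HA_linear[OF Phi_in_HA] g that by simp
      then interpret P: Vector_Spaces.linear scale scale "\<Phi> f (inv h \<otimes> g)"
        by (simp add: End_space_def)
      show ?thesis by (rule P.zero)
    qed
    then show ?thesis
      using g finite_carrier I.subset
      by (simp add: hecke_algebra_def, intro sum.mono_neutral_right) (auto simp: Phi_outside)
  qed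
  fix g v
  {
    assume g: "g \<in> carrier G" "g \<notin> I"
    have "\<Phi> f (inv h \<otimes> g) (\<Phi> f' h v) = 0" if h: "h \<in> I" for h
    proof -
      have hc: "h \<in> carrier G" using h by (rule I_carrier)
      have "inv h \<otimes> g \<notin> I"
      proof
        assume "inv h \<otimes> g \<in> I"
        then have "h \<otimes> (inv h \<otimes> g) \<in> I" using h by simp
        then show False using g hc by (simp flip: m_assoc)
      qed
      then show ?thesis using g hc by (simp add: Phi_outside)
    qed
    then show "(\<Phi> f \<otimes>\<^bsub>HA\<^esub> \<Phi> f') g v = 0" by (simp add: prod g)
  }
  assume g: "g \<in> I"
  then have gc: "g \<in> carrier G" by (rule I_carrier)
  let ?n = "of_nat (card N) :: complex"
  let ?T = "\<lambda>A. f (inv\<^bsub>H\<^esub> A \<otimes>\<^bsub>H\<^esub> (g <# N)) * f' A * \<eta> (inv\<^bsub>H\<^esub> (g <# N)) A"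
  have "\<Phi> f (inv h \<otimes> g) (\<Phi> f' h v) = scale (1 / ?n\<^sup>2 * ?T (h <# N)) (Theta_inv g v)"
    if h: "h \<in> I" for h
  proof -
    have hc: "h \<in> carrier G" using h by (rule I_carrier)
    have hg: "inv h \<otimes> g \<in> I" using h g by simp
    have "h \<otimes> (inv h \<otimes> g) = g" using gc hc by (simp flip: m_assoc)
    then have "Theta_inv (inv h \<otimes> g) (Theta_inv h v) = scale (\<tau> h (inv h \<otimes> g)) (Theta_inv g v)"
      using Theta_inv_mult[OF h hg, of v] by simp
    \<comment> \<open>Here equalization enters: composition produces the left scalar, the twisted
      product is defined with the right one.\<close>
    moreover have "\<tau> h (inv h \<otimes> g) = \<eta> (inv\<^bsub>H\<^esub> (g <# N)) (h <# N)"
      using h g hg by (simp add: H.eta_shift coset_in_H) (simp add: H_inv H_mult eta_coset)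
    ultimately show ?thesis
      using h hg g by (simp add: Phi_inertia unitary_op_scale[OF Theta_inv_unitary] H_inv H_mult
          power2_eq_square mult_ac)
  qed
  then have "(\<Phi> f \<otimes>\<^bsub>HA\<^esub> \<Phi> f') g v = scale (\<Sum>h\<in>I. 1 / ?n\<^sup>2 * ?T (h <# N)) (Theta_inv g v)"
    by (simp add: prod[OF gc] scale_sum_left)
  \<comment> \<open>Two values of \<open>\<Phi>\<close> contribute the inverse square of
    \<open>card N\<close>; the size of a coset restores one factor.\<close>
  also have "(\<Sum>h\<in>I. 1 / ?n\<^sup>2 * ?T (h <# N)) = ?n * (\<Sum>A\<in>carrier H. 1 / ?n\<^sup>2 * ?T A)"
    by (rule sum_inertia_cosets)
  also have "\<dots> = 1 / ?n * (f \<otimes>\<^bsub>L\<^esub> f') (g <# N)"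
    using g by (simp add: twisted_group_algebra_def coset_in_H power2_eq_square
        flip: sum_divide_distrib)
  finally show "(\<Phi> f \<otimes>\<^bsub>HA\<^esub> \<Phi> f') g v
    = scale (1 / ?n * (f \<otimes>\<^bsub>L\<^esub> f') (g <# N)) (Theta_inv g v)" .
qed

lemma Phi_add: "\<Phi> (f \<oplus>\<^bsub>L\<^esub> f') = \<Phi> f \<oplus>\<^bsub>HA\<^esub> \<Phi> f'"
  by (rule Phi_eqI[symmetric])
    (simp_all add: hecke_algebra_def twisted_group_algebra_def coset_in_H I_carrier Phi_inertia
      Phi_outside add_divide_distrib scale_left_distrib)

lemma Phi_smult: "\<Phi> (c \<odot>\<^bsub>L\<^esub> f) = c \<odot>\<^bsub>HA\<^esub> \<Phi> f"
  by (rule Phi_eqI[symmetric])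
    (simp_all add: hecke_algebra_def twisted_group_algebra_def coset_in_H I_carrier Phi_inertia
      Phi_outside)

lemma Phi_zero: "\<Phi> \<zero>\<^bsub>L\<^esub> = \<zero>\<^bsub>HA\<^esub>"
  by (rule Phi_eqI[symmetric])
    (simp_all add: hecke_algebra_def twisted_group_algebra_def coset_in_H I_carrier)

text \<open>The coset of \<open>g\<close> is trivial exactly for \<open>g\<close> in
  \<open>N\<close>, where the inverse of \<open>\<Theta> g\<close> is
  \<open>\<theta> (inv g)\<close>.\<close>

lemma Phi_one: "\<Phi> \<one>\<^bsub>L\<^esub> = \<one>\<^bsub>HA\<^esub>"
proof (rule Phi_eqI[symmetric])
  fix g v assume g: "g \<in> I"
  then have "g <# N = \<one>\<^bsub>H\<^esub> \<longleftrightarrow> g \<in> N"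
    using coset_eq_N_iff I_carrier by (simp add: FactGroup_def)
  then show "\<one>\<^bsub>HA\<^esub> g v = scale (1 / of_nat (card N) * \<one>\<^bsub>L\<^esub> (g <# N)) (Theta_inv g v)"
    using g by (simp add: hecke_algebra_def twisted_group_algebra_def coset_in_H I_carrier Theta_inv_N)
qed (use N_subset_I in \<open>auto simp: hecke_algebra_def\<close>)

lemma tau_inv:
  assumes "g \<in> I"
  shows "\<tau> g (inv g) = 1"
  using H.eta_inv_right[OF coset_in_H[OF assms]] assms by (simp add: H_inv eta_coset)

text \<open>Equalization in terms of operators: \<open>\<tau> g (inv g) = 1\<close> and
  \<open>\<Theta> \<one> = id\<close> say that the two operators compose to the identity.\<close>

lemma Theta_inverse: "g \<in> I \<Longrightarrow> \<Theta> (inv g) v = Theta_inv g v"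
  using Theta_mult[of g "inv g" v] Theta_inv_left[of g "\<Theta> (inv g) v"]
  by (simp add: tau_inv I_carrier Theta_one)

lemma Phi_star: "\<Phi> (star L f) = star HA (\<Phi> f)"
proof (rule Phi_eqI[symmetric])
  fix g v assume g: "g \<in> I"
  then have gc: "g \<in> carrier G" by (rule I_carrier)
  \<comment> \<open>The adjoint at \<open>inv g\<close> is a multiple of the inverse of this
    operator, that is, of the inverse of \<open>\<Theta> g\<close>.\<close>
  have "Theta_inv (inv g) = \<Theta> g"
    using Theta_inverse[of "inv g"] g gc by auto
  then have "inv_into UNIV (Theta_inv (inv g)) v = Theta_inv g v" by simp
  then show "star HA (\<Phi> f) g v
      = scale (1 / of_nat (card N) * star L f (g <# N)) (Theta_inv g v)"
    using g gc by (simp add: hecke_algebra_def twisted_group_algebra_def coset_in_H H_inv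
        Phi_inertia adjoint_op_scale_unitary[OF Theta_inv_unitary])
next
  fix g v assume g: "g \<in> carrier G" "g \<notin> I"
  then have "inv g \<notin> I" using I.m_inv_closed[of "inv g"] by auto
  then show "star HA (\<Phi> f) g v = 0"
    using g by (simp add: hecke_algebra_def Phi_outside adjoint_op_zero)
qed (simp add: hecke_algebra_def)

lemma Phi_star_iso: "star_iso L HA \<Phi>"
proof -
  have "involutive_algebra HA"
    by (rule involutive_algebra_image[OF H.involutive_algebra Phi_image])
      (simp_all add: Phi_mult Phi_add Phi_one Phi_zero Phi_smult Phi_star)
  moreover have "\<Phi> \<in> ring_iso L HA"
    using Phi_inj Phi_image by (auto simp: ring_iso_def ring_hom_def bij_betw_def Phi_in_HA
        Phi_mult Phi_add Phi_one)
  ultimately show ?thesis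
    by (simp add: star_iso_def H.involutive_algebra Phi_smult Phi_star)
qed

text \<open>The two square roots contribute one factor \<open>card N\<close>, which leaves 1/|N| in
  each term; each coset is then counted \<open>card N\<close> times.\<close>

lemma Phi_isometric:
  "sprod HA (of_real (sqrt (real (card N))) \<odot>\<^bsub>HA\<^esub> \<Phi> f) (of_real (sqrt (real (card N))) \<odot>\<^bsub>HA\<^esub> \<Phi> f')
    = sprod L f f'"
proof -
  let ?n = "of_nat (card N) :: complex" and ?s = "of_real (sqrt (real (card N))) :: complex"
  let ?d = "of_nat (dim (UNIV :: 'v set)) :: complex"
  let ?t = "\<lambda>g. 1 / ?d * trace_op scale Basis
    (adjoint_op scale ip ((?s \<odot>\<^bsub>HA\<^esub> \<Phi> f') g) \<circ> (?s \<odot>\<^bsub>HA\<^esub> \<Phi> f) g)"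
  obtain v :: 'v where v: "v \<noteq> 0" by (rule V_nonzero)
  then have d: "?d \<noteq> 0" using dim_eq_0[of UNIV] by (auto simp del: dim_UNIV)
  have ss: "?s * ?s = ?n" by (simp flip: of_real_mult)
  have "?t g = 1 / ?n * (f (g <# N) * cnj (f' (g <# N)))" if g: "g \<in> I" for g
  proof -
    have eq: "(?s \<odot>\<^bsub>HA\<^esub> \<Phi> f) g = (\<lambda>v. scale (?s / ?n * f (g <# N)) (Theta_inv g v))" for f
      using g by (simp add: hecke_algebra_def I_carrier Phi_inertia)
    \<comment> \<open>The inverse of \<open>\<Theta> g\<close> meets its own inverse, so the
      composite is a scalar and its normalized trace is that scalar.\<close>
    have "adjoint_op scale ip ((?s \<odot>\<^bsub>HA\<^esub> \<Phi> f') g) \<circ> (?s \<odot>\<^bsub>HA\<^esub> \<Phi> f) g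
      = scale (?s / ?n * cnj (f' (g <# N)) * (?s / ?n * f (g <# N)))"
      unfolding eq adjoint_op_scale_unitary[OF Theta_inv_unitary[OF g]]
      using Theta_inv_unitary[OF g]
      by (auto simp: fun_eq_iff unitary_op_scale[OF unitary_op_inv] unitary_op_def bij_is_inj)
    then have "?t g = ?s / ?n * cnj (f' (g <# N)) * (?s / ?n * f (g <# N))"
      using d by (simp add: trace_op_scale del: dim_UNIV)
    also have "\<dots> = (?s * ?s) / (?n * ?n) * (f (g <# N) * cnj (f' (g <# N)))" by simp
    finally show ?thesis using card_N_pos unfolding ss by simp
  qed
  moreover have "?t g = 0" if "g \<in> carrier G - I" for g
  proof -
    have "(?s \<odot>\<^bsub>HA\<^esub> \<Phi> f) g = (\<lambda>v. 0)" for f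
      using that by (simp add: hecke_algebra_def Phi_outside)
    \<comment> \<open>The zero operator is read as the scalar 0 so that
      \<open>trace_op_scale\<close> gives its trace.\<close>
    moreover have "scale 0 = (\<lambda>v. 0)" by (simp add: fun_eq_iff)
    ultimately show ?thesis
      using trace_op_scale[of 0] by (simp add: adjoint_op_zero comp_def)
  qed
  ultimately have "(\<Sum>g\<in>carrier G. ?t g) = (\<Sum>g\<in>I. 1 / ?n * (f (g <# N) * cnj (f' (g <# N))))"
    using finite_carrier I.subset
    by (intro sum.mono_neutral_cong_right) auto
  also have "\<dots> = ?n * (\<Sum>A\<in>carrier H. 1 / ?n * (f A * cnj (f' A)))"
    by (rule sum_inertia_cosets)
  also have "\<dots> = sprod L f f'"
    using card_N_pos by (simp add: twisted_group_algebra_def flip: sum_divide_distrib)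
  finally show ?thesis by (simp add: hecke_algebra_def)
qed

end

theorem theorem5p9:
  fixes G :: "('g, 'm) monoid_scheme" and N Q I :: "'g set"
    and scale :: "complex \<Rightarrow> 'v::ab_group_add \<Rightarrow> 'v" and Basis :: "'v set"
    and ip :: "'v \<Rightarrow> 'v \<Rightarrow> complex"
    and \<theta> \<Theta> :: "'g \<Rightarrow> 'v \<Rightarrow> 'v"
    and \<eta> :: "'g set \<Rightarrow> 'g set \<Rightarrow> complex"
    and H :: "'g set monoid"
    and L :: "('g set \<Rightarrow> complex) star_alg" and HA :: "('g \<Rightarrow> 'v \<Rightarrow> 'v) star_alg"
    and \<Phi> :: "('g set \<Rightarrow> complex) \<Rightarrow> 'g \<Rightarrow> 'v \<Rightarrow> 'v"
  defines "I \<equiv> inertia_group G N scale \<theta>"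
    and "H \<equiv> inertia_quotient G N scale \<theta>"
    and "\<eta> \<equiv> eta_of G scale \<Theta>"
    and "L \<equiv> twisted_group_algebra H \<eta>"
    and "HA \<equiv> hecke_algebra G N scale Basis ip \<theta>"
    and "\<Phi> \<equiv> Phi_map G N scale ip \<theta> \<Theta>"
  assumes "group G" and "finite (carrier G)" and "N \<lhd> G"
    and "complex_inner_space scale Basis ip"
    and "unitary_rep (G\<lparr>carrier := N\<rparr>) scale ip \<theta>"
    and "irreducible_rep (G\<lparr>carrier := N\<rparr>) scale \<theta>"
    and "Q \<subseteq> I" and "\<one>\<^bsub>G\<^esub> \<in> Q" and "\<forall>h\<in>I. \<exists>!q. q \<in> Q \<and> q \<in> h <#\<^bsub>G\<^esub> N"
    and "\<forall>q\<in>Q. unitary_op scale ip (\<Theta> q)"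
    and "\<forall>q\<in>Q. \<forall>n\<in>N.
           \<theta> (inv\<^bsub>G\<^esub> q \<otimes>\<^bsub>G\<^esub> n \<otimes>\<^bsub>G\<^esub> q) = inv_into UNIV (\<Theta> q) \<circ> \<theta> n \<circ> \<Theta> q"
    and "\<Theta> \<one>\<^bsub>G\<^esub> = id"
    and "\<forall>n\<in>N. \<forall>q\<in>Q. \<Theta> (n \<otimes>\<^bsub>G\<^esub> q) = \<theta> n \<circ> \<Theta> q"
    and "equalized H \<eta>"
  shows "(\<forall>F\<in>carrier HA. \<exists>f\<in>carrier L.
            (\<forall>h\<in>I. F h = (\<lambda>v. scale (1 / of_nat (card N) * f (h <#\<^bsub>G\<^esub> N))
                                    (adjoint_op scale ip (\<Theta> h) v))) \<and>
            (\<forall>g\<in>carrier G - I. F g = (\<lambda>v. 0)))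
       \<and> star_iso L HA \<Phi>
       \<and> (\<forall>f\<^sub>1\<in>carrier L. \<forall>f\<^sub>2\<in>carrier L.
            sprod HA (of_real (sqrt (real (card N))) \<odot>\<^bsub>HA\<^esub> \<Phi> f\<^sub>1)
                     (of_real (sqrt (real (card N))) \<odot>\<^bsub>HA\<^esub> \<Phi> f\<^sub>2) = sprod L f\<^sub>1 f\<^sub>2)"
proof -
  interpret N: normal N G by fact
  interpret V: complex_inner_space scale Basis ip by fact
  interpret T: inertia_intertwiners N G scale Basis ip Q \<theta> \<Theta>
    by unfold_locales (use assms in auto)
  \<comment> \<open>Identifies the names defined in the statement with the abbreviations of the
    locale.\<close>
  have I: "I = T.I" and L: "L = T.L" and HA: "HA = T.HA" and Phi: "\<Phi> = T.\<Phi>"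
    by (simp_all only: assms(1-6))
  have "\<exists>f\<in>carrier L.
      (\<forall>h\<in>I. F h = (\<lambda>v. scale (1 / of_nat (card N) * f (h <#\<^bsub>G\<^esub> N)) (adjoint_op scale ip (\<Theta> h) v))) \<and>
      (\<forall>g\<in>carrier G - I. F g = (\<lambda>v. 0))" if F: "F \<in> carrier HA" for F
  proof -
    obtain f where f: "f \<in> carrier L" "F = \<Phi> f"
      using F unfolding L HA Phi by (rule T.Phi_surj)
    have "F h = (\<lambda>v. scale (1 / of_nat (card N) * f (h <#\<^bsub>G\<^esub> N)) (adjoint_op scale ip (\<Theta> h) v))"
      if "h \<in> I" for h
      using that unfolding f(2) I Phi by (simp only: T.Phi_inertia T.Theta_unitary V.adjoint_op_unitary)
    moreover have "F g = (\<lambda>v. 0)" if "g \<in> carrier G - I" for g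
      using that unfolding f(2) I Phi by (intro T.Phi_outside) (simp_all only: Diff_iff not_False_eq_True)
    ultimately show ?thesis using f(1) by (intro bexI[of _ f] conjI ballI)
  qed
  moreover have "star_iso L HA \<Phi>"
    unfolding L HA Phi by (rule T.Phi_star_iso)
  moreover have "sprod HA (of_real (sqrt (real (card N))) \<odot>\<^bsub>HA\<^esub> \<Phi> f\<^sub>1)
      (of_real (sqrt (real (card N))) \<odot>\<^bsub>HA\<^esub> \<Phi> f\<^sub>2) = sprod L f\<^sub>1 f\<^sub>2" for f\<^sub>1 f\<^sub>2
    unfolding L HA Phi by (rule T.Phi_isometric)
  ultimately show ?thesis by (intro conjI ballI)
qed

end
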